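(* Let $\nu_n$ and $\nu$ be probability measures on $\mathcal H$, and let $\mathcal E_{A_n,\nu_n}$ on $L^2(\nu_n)$ and $\mathcal E_{A,\nu}$ on $L^2(\nu)$ be closed consistent forms. Assume that $\mathcal E_{A_n,\nu_n}$ converges to $\mathcal E_{A,\nu}$ in the Mosco sense, that $\nu_n\Rightarrow\nu$ weakly, and that there is a constant $C_{\mathrm{LSI}}^A<\infty$, the same for all $n$, such that $$\mathrm{Ent}(f^2\nu_n\|\nu_n)\le 2C_{\mathrm{LSI}}^A\,\mathcal E_{A_n,\nu_n}(f,f)$$ for all $n$ and all $f\in\operatorname{Dom}(\mathcal E_{A_n,\nu_n})$ with $\int f^2\,d\nu_n=1$. Then $$\mathrm{Ent}(f^2\nu\|\nu)\le 2C_{\mathrm{LSI}}^A\,\mathcal E_{A,\nu}(f,f)$$ for all $f\in\operatorname{Dom}(\mathcal E_{A,\nu})$ with $\int f^2\,d\nu=1$.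
   Context: $\mathcal H$ is a separable real Hilbert space and $Q$ a positive self-adjoint trace-class operator on it. For a field $x\mapsto D(x)$ of positive self-adjoint bounded operators (respectively $D_n(x)$), put $A(x)=D(x)^{1/2}QD(x)^{1/2}$ (respectively $A_n$) and $\Gamma_A(u,v)(x)=\langle Q^{1/2}D(x)^{1/2}\nabla u(x),Q^{1/2}D(x)^{1/2}\nabla v(x)\rangle$ for $u,v\in\mathcal{FC}_b^\infty$, the class of functions $f(\langle x,h_1\rangle,\dots,\langle x,h_m\rangle)$ with $f\in C_b^\infty(\mathbb R^m)$, $h_i\in\mathcal H$. $\mathcal E_{A,\nu}$ is the closure in $L^2(\nu)$ of $\mathcal E_{A,\nu}(u,v)=\int\Gamma_A(u,v)\,d\nu$ on $\mathcal{FC}_b^\infty$; similarly $\mathcal E_{A_n,\nu_n}$. $\mathrm{Ent}(\cdot\|\cdot)$ is relative entropy: $\mathrm{Ent}(f^2\nu\|\nu)=\int f^2\log f^2\,d\nu$ when $\int f^2d\nu=1$. Convergence along varying $L^2$ spaces (Kuwae–Shioya): $f_n\in L^2(\nu_n)$ converges strongly to $f\in L^2(\nu)$ if there are $\varphi_m\in\mathcal{FC}_b^\infty$ with $\varphi_m\to f$ in $L^2(\nu)$ and $\lim_m\limsup_n\|\varphi_m-f_n\|_{L^2(\nu_n)}=0$; it converges weakly if $\langle f_n,g_n\rangle_{L^2(\nu_n)}\to\langle f,g\rangle_{L^2(\nu)}$ for every strongly convergent $g_n\to g$. Mosco convergence $\mathcal E_n\to\mathcal E$ means: (liminf) $\mathcal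 E(f,f)\le\liminf_n\mathcal E_n(f_n,f_n)$ whenever $f_n\to f$ weakly (forms being $+\infty$ off their domains); (limsup recovery) for each $f\in\operatorname{Dom}(\mathcal E)$ there are $f_n\to f$ strongly with $\limsup_n\mathcal E_n(f_n,f_n)\le\mathcal E(f,f)$. *)

theory Defs
  imports "HOL-Probability.Probability"
begin

section \<open>Operators on a Hilbert space\<close>

text \<open>A separable real Hilbert space is a type of sort
  \<open>{real_inner, polish_space}\<close>: an inner product space that is complete and second countable.
  Positive means nonnegative; injectivity is not required.\<close>

definition positive_op :: "('h::real_inner \<Rightarrow>\<^sub>L 'h) \<Rightarrow> bool" where
  "positive_op T \<longleftrightarrow> (\<forall>x y. T x \<bullet> y = x \<bullet> T y) \<and> (\<forall>x. 0 \<le> T x \<bullet> x)"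

definition op_sqrt :: "('h::real_inner \<Rightarrow>\<^sub>L 'h) \<Rightarrow> ('h \<Rightarrow>\<^sub>L 'h)" where
  "op_sqrt T = (THE S. positive_op S \<and> S o\<^sub>L S = T)"

definition orthonormal_basis :: "'h::real_inner set \<Rightarrow> bool" where
  "orthonormal_basis B \<longleftrightarrow>
     pairwise orthogonal B \<and> (\<forall>e\<in>B. norm e = 1) \<and> closure (span B) = UNIV"

text \<open>A positive operator equals its absolute value, so it is trace class iff its trace is finite.\<close>

definition positive_trace_class :: "('h::real_inner \<Rightarrow>\<^sub>L 'h) \<Rightarrow> bool" where
  "positive_trace_class Q \<longleftrightarrow>
     positive_op Q \<and> (\<exists>B. orthonormal_basis B \<and> (\<lambda>e. Q e \<bullet> e) summable_on B)"


section \<open>Smooth cylinder functions\<close>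

text \<open>Since \<open>m\<close> has to vary inside a formula, a function on \<open>\<real>\<^sup>m\<close> is represented by a function of
  \<open>y :: nat \<Rightarrow> real\<close> that depends only on \<open>y 0, \<dots>, y (m - 1)\<close>. For such functions, continuity in the
  product topology is continuity on \<open>\<real>\<^sup>m\<close>.\<close>

definition partial :: "nat \<Rightarrow> ((nat \<Rightarrow> real) \<Rightarrow> real) \<Rightarrow> ((nat \<Rightarrow> real) \<Rightarrow> real)" where
  "partial i f y = deriv (\<lambda>t. f (y(i := t))) (y i)"

definition Cb_infinity :: "nat \<Rightarrow> ((nat \<Rightarrow> real) \<Rightarrow> real) set" where
  "Cb_infinity m = {f.
     (\<forall>y z. (\<forall>i<m. y i = z i) \<longrightarrow> f y = f z) \<and>
     (\<forall>is. set is \<subseteq> {..<m} \<longrightarrow>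
        continuous_on UNIV (foldr partial is f) \<and>
        bounded (range (foldr partial is f)) \<and>
        (\<forall>i<m. \<forall>y. (\<lambda>t. foldr partial is f (y(i := t))) differentiable (at (y i))))}"

definition FCb_infinity :: "('h::real_inner \<Rightarrow> real) set" where
  "FCb_infinity = {u. \<exists>m f h. f \<in> Cb_infinity m \<and> u = (\<lambda>x. f (\<lambda>i. x \<bullet> h i))}"

definition grad :: "('h::real_inner \<Rightarrow> real) \<Rightarrow> 'h \<Rightarrow> 'h" where
  "grad u x = (THE d. GDERIV u x :> d)"


section \<open>Square-integrable functions\<close>

text \<open>Elements of \<open>L\<^sup>2\<close> are represented by functions; every notion below is invariant under
  changes on null sets.\<close>

definition L2_space :: "'h measure \<Rightarrow> ('h \<Rightarrow> real) set" where
  "L2_space \<nu> = {f \<in> borel_measurable \<nu>. integrable \<nu> (\<lambda>x. (f x)\<^sup>2)}"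

definition L2_inner :: "'h measure \<Rightarrow> ('h \<Rightarrow> real) \<Rightarrow> ('h \<Rightarrow> real) \<Rightarrow> real" where
  "L2_inner \<nu> f g = (\<integral>x. f x * g x \<partial>\<nu>)"

definition L2_norm :: "'h measure \<Rightarrow> ('h \<Rightarrow> real) \<Rightarrow> real" where
  "L2_norm \<nu> f = sqrt (L2_inner \<nu> f f)"


section \<open>The forms\<close>

text \<open>The operator \<open>A(x) = D(x)\<^sup>1\<^sup>/\<^sup>2 Q D(x)\<^sup>1\<^sup>/\<^sup>2\<close> enters only through \<open>Q\<close> and \<open>D\<close>.\<close>

definition Gamma ::
  "('h::real_inner \<Rightarrow>\<^sub>L 'h) \<Rightarrow> ('h \<Rightarrow> 'h \<Rightarrow>\<^sub>L 'h) \<Rightarrow> ('h \<Rightarrow> real) \<Rightarrow> ('h \<Rightarrow> real) \<Rightarrow> 'h \<Rightarrow> real" where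
  "Gamma Q D u v x = op_sqrt Q (op_sqrt (D x) (grad u x)) \<bullet> op_sqrt Q (op_sqrt (D x) (grad v x))"

definition pre_form ::
  "('h::real_inner \<Rightarrow>\<^sub>L 'h) \<Rightarrow> ('h \<Rightarrow> 'h \<Rightarrow>\<^sub>L 'h) \<Rightarrow> 'h measure \<Rightarrow> ('h \<Rightarrow> real) \<Rightarrow> ('h \<Rightarrow> real) \<Rightarrow> real"
  where "pre_form Q D \<nu> u v = (\<integral>x. Gamma Q D u v x \<partial>\<nu>)"

definition approximating ::
  "('h::real_inner \<Rightarrow>\<^sub>L 'h) \<Rightarrow> ('h \<Rightarrow> 'h \<Rightarrow>\<^sub>L 'h) \<Rightarrow> 'h measure \<Rightarrow> (nat \<Rightarrow> 'h \<Rightarrow> real) \<Rightarrow> ('h \<Rightarrow> real) \<Rightarrow> bool"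
  where
  "approximating Q D \<nu> u f \<longleftrightarrow>
     (\<forall>k. u k \<in> FCb_infinity) \<and> f \<in> L2_space \<nu> \<and>
     (\<lambda>k. L2_norm \<nu> (\<lambda>x. u k x - f x)) \<longlonglongrightarrow> 0 \<and>
     (\<forall>e>0. \<exists>N. \<forall>i\<ge>N. \<forall>j\<ge>N.
        pre_form Q D \<nu> (\<lambda>x. u i x - u j x) (\<lambda>x. u i x - u j x) < e)"

text \<open>The first conjunct says that the pre-form is a genuine (finite) integral, the second that it
  is closable. Applied to constant sequences, the second one also yields consistency: the pre-form
  depends only on the \<open>\<nu>\<close>-classes of its arguments.\<close>

definition closable_form ::
  "('h::real_inner \<Rightarrow>\<^sub>L 'h) \<Rightarrow> ('h \<Rightarrow> 'h \<Rightarrow>\<^sub>L 'h) \<Rightarrow> 'h measure \<Rightarrow> bool" where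
  "closable_form Q D \<nu> \<longleftrightarrow>
     (\<forall>u\<in>FCb_infinity. \<forall>v\<in>FCb_infinity. integrable \<nu> (Gamma Q D u v)) \<and>
     (\<forall>u. approximating Q D \<nu> u (\<lambda>_. 0) \<longrightarrow> (\<lambda>k. pre_form Q D \<nu> (u k) (u k)) \<longlonglongrightarrow> 0)"

text \<open>The closure of the pre-form, meaningful if \<^const>\<open>closable_form\<close> holds.\<close>

definition form_dom ::
  "('h::real_inner \<Rightarrow>\<^sub>L 'h) \<Rightarrow> ('h \<Rightarrow> 'h \<Rightarrow>\<^sub>L 'h) \<Rightarrow> 'h measure \<Rightarrow> ('h \<Rightarrow> real) set" where
  "form_dom Q D \<nu> = {f. \<exists>u. approximating Q D \<nu> u f}"

definition form ::
  "('h::real_inner \<Rightarrow>\<^sub>L 'h) \<Rightarrow> ('h \<Rightarrow> 'h \<Rightarrow>\<^sub>L 'h) \<Rightarrow> 'h measure \<Rightarrow> ('h \<Rightarrow> real) \<Rightarrow> ('h \<Rightarrow> real) \<Rightarrow> real"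
  where
  "form Q D \<nu> f g =
     (THE c. \<forall>u v. approximating Q D \<nu> u f \<longrightarrow> approximating Q D \<nu> v g \<longrightarrow>
        (\<lambda>k. pre_form Q D \<nu> (u k) (v k)) \<longlonglongrightarrow> c)"

definition form_energy ::
  "('h::real_inner \<Rightarrow>\<^sub>L 'h) \<Rightarrow> ('h \<Rightarrow> 'h \<Rightarrow>\<^sub>L 'h) \<Rightarrow> 'h measure \<Rightarrow> ('h \<Rightarrow> real) \<Rightarrow> ereal" where
  "form_energy Q D \<nu> f = (if f \<in> form_dom Q D \<nu> then ereal (form Q D \<nu> f f) else \<infinity>)"


section \<open>Convergence along varying \<open>L\<^sup>2\<close> spaces\<close>

definition weak_conv_measures ::
  "(nat \<Rightarrow> 'h::topological_space measure) \<Rightarrow> 'h measure \<Rightarrow> bool" where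
  "weak_conv_measures \<nu>n \<nu> \<longleftrightarrow>
     (\<forall>g :: 'h \<Rightarrow> real. continuous_on UNIV g \<longrightarrow> bounded (range g) \<longrightarrow>
        (\<lambda>n. \<integral>x. g x \<partial>\<nu>n n) \<longlonglongrightarrow> (\<integral>x. g x \<partial>\<nu>))"

definition L2_strong_conv ::
  "(nat \<Rightarrow> 'h::real_inner measure) \<Rightarrow> 'h measure \<Rightarrow> (nat \<Rightarrow> 'h \<Rightarrow> real) \<Rightarrow> ('h \<Rightarrow> real) \<Rightarrow> bool" where
  "L2_strong_conv \<nu>n \<nu> fn f \<longleftrightarrow>
     (\<forall>n. fn n \<in> L2_space (\<nu>n n)) \<and> f \<in> L2_space \<nu> \<and>
     (\<exists>\<phi>. (\<forall>m. \<phi> m \<in> FCb_infinity) \<and>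
        (\<lambda>m. L2_norm \<nu> (\<lambda>x. \<phi> m x - f x)) \<longlonglongrightarrow> 0 \<and>
        (\<lambda>m. limsup (\<lambda>n. ereal (L2_norm (\<nu>n n) (\<lambda>x. \<phi> m x - fn n x)))) \<longlonglongrightarrow> 0)"

definition L2_weak_conv ::
  "(nat \<Rightarrow> 'h::real_inner measure) \<Rightarrow> 'h measure \<Rightarrow> (nat \<Rightarrow> 'h \<Rightarrow> real) \<Rightarrow> ('h \<Rightarrow> real) \<Rightarrow> bool" where
  "L2_weak_conv \<nu>n \<nu> fn f \<longleftrightarrow>
     (\<forall>n. fn n \<in> L2_space (\<nu>n n)) \<and> f \<in> L2_space \<nu> \<and>
     (\<forall>gn g. L2_strong_conv \<nu>n \<nu> gn g \<longrightarrow>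
        (\<lambda>n. L2_inner (\<nu>n n) (fn n) (gn n)) \<longlonglongrightarrow> L2_inner \<nu> f g)"

definition Mosco_conv ::
  "('h::real_inner \<Rightarrow>\<^sub>L 'h) \<Rightarrow> (nat \<Rightarrow> 'h \<Rightarrow> 'h \<Rightarrow>\<^sub>L 'h) \<Rightarrow> (nat \<Rightarrow> 'h measure) \<Rightarrow>
     ('h \<Rightarrow> 'h \<Rightarrow>\<^sub>L 'h) \<Rightarrow> 'h measure \<Rightarrow> bool" where
  "Mosco_conv Q Dn \<nu>n D \<nu> \<longleftrightarrow>
     (\<forall>fn f. L2_weak_conv \<nu>n \<nu> fn f \<longrightarrow>
        form_energy Q D \<nu> f \<le> liminf (\<lambda>n. form_energy Q (Dn n) (\<nu>n n) (fn n))) \<and>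
     (\<forall>f\<in>form_dom Q D \<nu>. \<exists>fn. L2_strong_conv \<nu>n \<nu> fn f \<and>
        limsup (\<lambda>n. form_energy Q (Dn n) (\<nu>n n) (fn n)) \<le> form_energy Q D \<nu> f)"


section \<open>Relative entropy\<close>

text \<open>\<open>KL_divergence b \<nu> \<mu>\<close> is the divergence of \<open>\<mu>\<close> from \<open>\<nu>\<close>, with value \<open>0\<close> if the integrand is not
  integrable. For probability measures \<open>\<mu> \<lless> \<nu>\<close> the negative part of the integrand is always
  integrable, so that non-integrability means that the entropy is \<open>\<infinity>\<close>.\<close>

definition rel_entropy :: "'h measure \<Rightarrow> 'h measure \<Rightarrow> ereal" where
  "rel_entropy \<mu> \<nu> =
     (if absolutely_continuous \<nu> \<mu> \<and> integrable \<mu> (entropy_density (exp 1) \<nu> \<mu>)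
      then ereal (KL_divergence (exp 1) \<nu> \<mu>) else \<infinity>)"

end

theory Submission
  imports Defs
begin

text \<open>The log-Sobolev inequality passes to the limit in its dual form: by \<open>s t \<le> s ln s + e\<^sup>t\<^sup>-\<^sup>1\<close>, it
  bounds \<open>\<integral> \<psi> f\<^sup>2 d\<nu>\<^sub>n - \<integral> e\<^sup>\<psi>\<^sup>-\<^sup>1 d\<nu>\<^sub>n\<close> by \<open>2 C \<E>\<^sub>n(f, f)\<close> for every bounded continuous \<open>\<psi>\<close>. Along a
  normalised Mosco recovery sequence both sides converge: the left one by strong convergence and
  \<open>\<nu>\<^sub>n \<Rightarrow> \<nu>\<close>, the right one because strong convergence implies weak convergence, so that the liminf
  condition applies to the recovery sequence too. Taking
  \<open>\<psi>\<close> close to \<open>1 + ln f\<^sup>2\<close> in the limit recovers the entropy. Normalising the recovery sequence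
  requires the closure to be quadratic, which rests on cylinder functions forming a vector space on
  which the gradient is linear.\<close>

section \<open>Smooth cylinder functions\<close>

text \<open>Strong convergence along varying spaces gives no pointwise convergence of the functions
  \<open>fn n\<close>, which live under different measures, so Fatou's lemma cannot carry f^2 ln f^2
  to the limit. In the dual form \<open>fn n\<close> occurs only quadratically, against a fixed
  bounded continuous weight, and such integrals converge under strong convergence. The ideal test
  function is neither bounded nor continuous: f is a mere L^2 function, and ln is unbounded at both
  ends. Hence f is replaced by cylinder functions that approximate it in L^2 of the limit measure,
  and the argument of the logarithm is clipped to an interval [eps, M]. Each regularisation is
  removed by its own means: the approximation by dominated convergence, eps as a vanishing additive
  error, M by monotone convergence. The last also yields the integrability of f^2 ln f^2, which is
  not known beforehand.\<close>

lemma Cb_infinity_coinduct: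
  assumes "f \<in> S"
    and dep: "\<And>y z. (\<And>i. i < m \<Longrightarrow> y i = z i) \<Longrightarrow> f y = f z"
    and cont: "\<And>s. s \<in> S \<Longrightarrow> continuous_on UNIV s"
    and bdd: "\<And>s. s \<in> S \<Longrightarrow> bounded (range s)"
    and diff: "\<And>s i y. s \<in> S \<Longrightarrow> i < m \<Longrightarrow> (\<lambda>t. s (y(i := t))) differentiable (at (y i))"
    and step: "\<And>s i. s \<in> S \<Longrightarrow> i < m \<Longrightarrow> partial i s \<in> S"
  shows "f \<in> Cb_infinity m"
proof -
  \<comment> \<open>Closure of \<open>S\<close> under \<open>partial\<close> keeps every iterated
    partial derivative in \<open>S\<close>, so conditions on single members of \<open>S\<close>
    replace conditions on all index lists.\<close>
  have S: "foldr partial is f \<in> S" if "set is \<subseteq> {..<m}" for "is"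
    using that
  proof (induction "is")
    case Nil
    show ?case
      using \<open>f \<in> S\<close> by simp
  next
    case (Cons i "is")
    then show ?case
      using step[of _ i] by simp
  qed
  show ?thesis
    unfolding Cb_infinity_def mem_Collect_eq
  proof (intro conjI allI impI)
    show "f y = f z" if "\<forall>i<m. y i = z i" for y z
      using that by (intro dep) simp
  qed (auto intro: cont[OF S] bdd[OF S] diff[OF S])
qed

context
  fixes m :: nat and f :: "(nat \<Rightarrow> real) \<Rightarrow> real"
  assumes f: "f \<in> Cb_infinity m"
begin

lemma Cb_infinity_cong: "(\<And>i. i < m \<Longrightarrow> y i = z i) \<Longrightarrow> f y = f z"
  by (rule f[unfolded Cb_infinity_def mem_Collect_eq, THEN conjunct1, rule_format])

lemma Cb_infinity_derivatives:
  assumes "set is \<subseteq> {..<m}"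
  shows "continuous_on UNIV (foldr partial is f) \<and> bounded (range (foldr partial is f)) \<and>
    (\<forall>i<m. \<forall>y. (\<lambda>t. foldr partial is f (y(i := t))) differentiable (at (y i)))"
  by (rule f[unfolded Cb_infinity_def mem_Collect_eq, THEN conjunct2, THEN spec, THEN mp, OF assms])

lemma Cb_infinity_continuous: "continuous_on UNIV f"
  using Cb_infinity_derivatives[of "[]"] by simp

lemma Cb_infinity_bounded: "bounded (range f)"
  using Cb_infinity_derivatives[of "[]"] by simp

lemma Cb_infinity_has_partial:
  assumes "i < m"
  shows "((\<lambda>t. f (y(i := t))) has_real_derivative partial i f (y(i := s))) (at s)"
proof -
  have "(\<lambda>t. f (y(i := t))) differentiable at s"
    using Cb_infinity_derivatives[of "[]", THEN conjunct2, THEN conjunct2, THEN spec, THEN mp,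
        OF _ assms, THEN spec, of "y(i := s)"] by simp
  then show ?thesis
    by (simp add: partial_def DERIV_deriv_iff_real_differentiable)
qed

lemma Cb_infinity_partial:
  assumes "i < m"
  shows "partial i f \<in> Cb_infinity m"
proof -
  have dep: "partial i f y = partial i f z" if "\<And>j. j < m \<Longrightarrow> y j = z j" for y z
  proof -
    have "f (y(i := t)) = f (z(i := t))" for t
      using that by (intro Cb_infinity_cong) simp
    then show ?thesis
      using that \<open>i < m\<close> by (simp add: partial_def)
  qed
  show ?thesis
    unfolding Cb_infinity_def mem_Collect_eq
  proof (intro conjI[of "\<forall>y z. _ y z"] allI impI)
    show "partial i f y = partial i f z" if "\<forall>j<m. y j = z j" for y z
      using that by (intro dep) simp
    fix "is" assume "set is \<subseteq> {..<m}"
    \<comment> \<open>\<open>foldr\<close> applies the last entry of the list first, so the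
      derivatives of \<open>partial i f\<close> along \<open>is\<close> are those of
      \<open>f\<close> along \<open>is @ [i]\<close>.\<close>
    then have "set (is @ [i]) \<subseteq> {..<m}"
      using \<open>i < m\<close> by auto
    from Cb_infinity_derivatives[OF this]
    show "continuous_on UNIV (foldr partial is (partial i f)) \<and>
        bounded (range (foldr partial is (partial i f))) \<and>
        (\<forall>j<m. \<forall>y. (\<lambda>t. foldr partial is (partial i f) (y(j := t))) differentiable (at (y j)))"
      unfolding foldr_append foldr.simps o_apply id_apply .
  qed
qed

end

lemma partial_eqI:
  assumes "((\<lambda>t. f (y(i := t))) has_real_derivative d) (at (y i))"
  shows "partial i f y = d"
  unfolding partial_def using assms by (rule DERIV_imp_deriv)

lemma Cb_infinity_zero: "(\<lambda>_. 0) \<in> Cb_infinity m"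
  by (rule Cb_infinity_coinduct[where S = "{\<lambda>_. 0}"]) (simp_all add: partial_def fun_eq_iff)

lemma Cb_infinity_scale:
  assumes "f \<in> Cb_infinity m"
  shows "(\<lambda>y. c * f y) \<in> Cb_infinity m"
proof (rule Cb_infinity_coinduct[where S = "(\<lambda>a y. c * a y) ` Cb_infinity m"])
  show "(\<lambda>y. c * f y) \<in> (\<lambda>a y. c * a y) ` Cb_infinity m"
    using assms by (rule imageI)
  show "c * f y = c * f z" if "\<And>i. i < m \<Longrightarrow> y i = z i" for y z
    using Cb_infinity_cong[OF assms that] by simp
next
  fix s assume "s \<in> (\<lambda>a y. c * a y) ` Cb_infinity m"
  then obtain a where a: "a \<in> Cb_infinity m" and s: "s = (\<lambda>y. c * a y)" by blast
  show "continuous_on UNIV s"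
    unfolding s by (intro continuous_intros Cb_infinity_continuous[OF a])
  have "range s = (\<lambda>t. c *\<^sub>R t) ` range a"
    unfolding s by auto
  then show "bounded (range s)"
    using bounded_scaling[OF Cb_infinity_bounded[OF a]] by simp
  fix i assume "i < m"
  have D: "((\<lambda>t. s (y(i := t))) has_real_derivative c * partial i a y) (at (y i))" for y
    unfolding s using Cb_infinity_has_partial[OF a \<open>i < m\<close>, of y "y i"]
    by (auto intro!: DERIV_cmult)
  then show "(\<lambda>t. s (y(i := t))) differentiable at (y i)" for y
    using real_differentiable_def by blast
  show "partial i s \<in> (\<lambda>a y. c * a y) ` Cb_infinity m"
  proof -
    have "partial i s = (\<lambda>y. c * partial i a y)"
      using D by (intro ext partial_eqI)
    then show ?thesis
      using Cb_infinity_partial[OF a \<open>i < m\<close>] by blast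
  qed
qed

lemma continuous_on_shift: "continuous_on UNIV (\<lambda>y :: nat \<Rightarrow> real. \<lambda>i. y (i + m))"
  by (rule continuous_on_coordinatewise_then_product) (rule continuous_on_product_coordinates)

text \<open>The two functions read disjoint blocks of variables, the second block starting at index
  \<open>m\<close>. A partial derivative therefore hits only one of them and turns the other into 0.
  As 0 lies in both classes, the differences \<open>\<Phi> a b\<close> form a set closed under
  \<open>partial\<close>.\<close>

lemma Cb_infinity_diff_shift:
  assumes "f \<in> Cb_infinity m" "g \<in> Cb_infinity n"
  shows "(\<lambda>y. f y - g (\<lambda>i. y (i + m))) \<in> Cb_infinity (m + n)"
proof -
  define \<Phi> where "\<Phi> a b = (\<lambda>y. a y - b (\<lambda>i. y (i + m)))" for a b :: "(nat \<Rightarrow> real) \<Rightarrow> real"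
  define S where "S = {\<Phi> a b |a b. a \<in> Cb_infinity m \<and> b \<in> Cb_infinity n}"
  have "\<Phi> f g \<in> Cb_infinity (m + n)"
  proof (rule Cb_infinity_coinduct[where S = S])
    show "\<Phi> f g \<in> S"
      using assms by (auto simp: S_def)
    show "\<Phi> f g y = \<Phi> f g z" if "\<And>i. i < m + n \<Longrightarrow> y i = z i" for y z
      using that Cb_infinity_cong[OF assms(1), of y z]
        Cb_infinity_cong[OF assms(2), of "\<lambda>i. y (i + m)" "\<lambda>i. z (i + m)"]
      by (simp add: \<Phi>_def)
  next
    fix s assume "s \<in> S"
    then obtain a b where a: "a \<in> Cb_infinity m" and b: "b \<in> Cb_infinity n" and s: "s = \<Phi> a b"
      by (auto simp: S_def)
    show "continuous_on UNIV s"
      unfolding s \<Phi>_def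
      by (intro continuous_intros Cb_infinity_continuous[OF a] continuous_on_shift
          continuous_on_compose2[OF Cb_infinity_continuous[OF b]]) auto
    obtain A B where "\<And>y. \<bar>a y\<bar> \<le> A" "\<And>y. \<bar>b y\<bar> \<le> B"
      using Cb_infinity_bounded[OF a] Cb_infinity_bounded[OF b] unfolding bounded_iff by auto
    then have "\<bar>s y\<bar> \<le> A + B" for y
      unfolding s \<Phi>_def by (smt (verit))
    then show "bounded (range s)"
      unfolding bounded_iff by auto
    fix i assume "i < m + n"
    have "\<exists>a' b'. a' \<in> Cb_infinity m \<and> b' \<in> Cb_infinity n \<and>
      (\<forall>y. ((\<lambda>t. s (y(i := t))) has_real_derivative \<Phi> a' b' y) (at (y i)))"
    proof (cases "i < m")
      case True
      have "((\<lambda>t. s (y(i := t))) has_real_derivative \<Phi> (partial i a) (\<lambda>_. 0) y) (at (y i))" for y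
      proof -
        have "((\<lambda>t. a (y(i := t)) - b (\<lambda>j. y (j + m))) has_real_derivative partial i a y - 0) (at (y i))"
          using Cb_infinity_has_partial[OF a True, of y "y i"] by (intro DERIV_diff DERIV_const) simp
        moreover have "(\<lambda>t. s (y(i := t))) = (\<lambda>t. a (y(i := t)) - b (\<lambda>j. y (j + m)))"
          using True by (auto simp: s \<Phi>_def fun_upd_def intro!: arg_cong[of _ _ b])
        ultimately show ?thesis
          by (simp add: \<Phi>_def)
      qed
      then show ?thesis
        using Cb_infinity_partial[OF a True] Cb_infinity_zero by blast
    next
      case False
      define k where "k = i - m"
      have k: "k < n" "i = k + m"
        using False \<open>i < m + n\<close> by (auto simp: k_def)
      have "((\<lambda>t. s (y(i := t))) has_real_derivative \<Phi> (\<lambda>_. 0) (partial k b) y) (at (y i))" for y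
      proof -
        have "((\<lambda>t. a y - b ((\<lambda>j. y (j + m))(k := t))) has_real_derivative
            0 - partial k b (\<lambda>j. y (j + m))) (at (y i))"
          using Cb_infinity_has_partial[OF b k(1), of "\<lambda>j. y (j + m)" "y i"]
          by (intro DERIV_diff DERIV_const) (simp add: k fun_upd_idem)
        moreover have "(\<lambda>t. s (y(i := t))) = (\<lambda>t. a y - b ((\<lambda>j. y (j + m))(k := t)))"
        proof
          fix t
          have "a (y(i := t)) = a y"
            using k by (intro Cb_infinity_cong[OF a]) auto
          moreover have "(\<lambda>j. (y(i := t)) (j + m)) = (\<lambda>j. y (j + m))(k := t)"
            using k by auto
          ultimately show "s (y(i := t)) = a y - b ((\<lambda>j. y (j + m))(k := t))"
            unfolding s \<Phi>_def by simp
        qed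
        ultimately show ?thesis
          by (simp add: \<Phi>_def)
      qed
      then show ?thesis
        using Cb_infinity_partial[OF b k(1)] Cb_infinity_zero by blast
    qed
    then obtain a' b' where ab': "a' \<in> Cb_infinity m" "b' \<in> Cb_infinity n"
      and D: "\<And>y. ((\<lambda>t. s (y(i := t))) has_real_derivative \<Phi> a' b' y) (at (y i))"
      by blast
    show "(\<lambda>t. s (y(i := t))) differentiable at (y i)" for y
      using D real_differentiable_def by blast
    have "partial i s = \<Phi> a' b'"
      using D by (intro ext partial_eqI)
    then show "partial i s \<in> S"
      using ab' by (auto simp: S_def)
  qed
  then show ?thesis
    by (simp add: \<Phi>_def)
qed

section \<open>Cylinder functions on the Hilbert space and their gradients\<close>

lemma FCb_infinityI: "f \<in> Cb_infinity m \<Longrightarrow> (\<lambda>x. f (\<lambda>i. x \<bullet> h i)) \<in> FCb_infinity"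
  unfolding FCb_infinity_def mem_Collect_eq by (intro exI conjI) (assumption, rule refl)

lemma FCb_infinityE:
  assumes "u \<in> FCb_infinity"
  obtains m f h where "f \<in> Cb_infinity m" "u = (\<lambda>x. f (\<lambda>i. x \<bullet> h i))"
  using assms unfolding FCb_infinity_def mem_Collect_eq by (elim exE conjE)

lemma FCb_infinity_scale:
  assumes "u \<in> FCb_infinity"
  shows "(\<lambda>x. c * u x) \<in> FCb_infinity"
proof -
  obtain m f h where f: "f \<in> Cb_infinity m" and u: "u = (\<lambda>x. f (\<lambda>i. x \<bullet> h i))"
    using assms by (rule FCb_infinityE)
  show ?thesis
    using FCb_infinityI[OF Cb_infinity_scale[OF f], of c h] by (simp add: u)
qed

lemma FCb_infinity_diff:
  assumes "u \<in> FCb_infinity" "v \<in> FCb_infinity"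
  shows "(\<lambda>x. u x - v x) \<in> FCb_infinity"
proof -
  obtain m f h where f: "f \<in> Cb_infinity m" and u: "u = (\<lambda>x. f (\<lambda>i. x \<bullet> h i))"
    using assms(1) by (rule FCb_infinityE)
  obtain n g k where g: "g \<in> Cb_infinity n" and v: "v = (\<lambda>x. g (\<lambda>i. x \<bullet> k i))"
    using assms(2) by (rule FCb_infinityE)
  \<comment> \<open>The vectors \<open>h i\<close> with \<open>i \<ge> m\<close> are never read by
    \<open>f\<close>, so they may be overwritten by those of \<open>v\<close>; one family of vectors
    then serves both functions.\<close>
  define hk where "hk i = (if i < m then h i else k (i - m))" for i
  have "f (\<lambda>i. x \<bullet> h i) = f (\<lambda>i. x \<bullet> hk i)" for x
    by (intro Cb_infinity_cong[OF f]) (simp add: hk_def)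
  moreover have "g (\<lambda>i. x \<bullet> k i) = g (\<lambda>i. x \<bullet> hk (i + m))" for x
    by (simp add: hk_def)
  ultimately show ?thesis
    using FCb_infinityI[OF Cb_infinity_diff_shift[OF f g], of hk] by (simp add: u v)
qed

lemma FCb_infinity_continuous:
  assumes "u \<in> FCb_infinity"
  shows "continuous_on UNIV u"
proof -
  obtain m f h where f: "f \<in> Cb_infinity m" and u: "u = (\<lambda>x. f (\<lambda>i. x \<bullet> h i))"
    using assms by (rule FCb_infinityE)
  show ?thesis
    unfolding u
    by (intro continuous_on_compose2[OF Cb_infinity_continuous[OF f]]
        continuous_on_coordinatewise_then_product continuous_intros) auto
qed

lemma FCb_infinity_bounded:
  assumes "u \<in> FCb_infinity"
  shows "bounded (range u)"
proof -
  obtain m f h where f: "f \<in> Cb_infinity m" and u: "u = (\<lambda>x. f (\<lambda>i. x \<bullet> h i))"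
    using assms by (rule FCb_infinityE)
  have "range u \<subseteq> range f"
    unfolding u by auto
  then show ?thesis
    using Cb_infinity_bounded[OF f] bounded_subset by blast
qed

text \<open>Continuous partial derivatives give differentiability, one coordinate at a time: only
  the first \<open>k\<close> coordinates follow \<open>z\<close>, the others stay frozen at
  \<open>x\<close>. Releasing coordinate \<open>k\<close> means treating it as an independent real
  variable \<open>t\<close>, in which the partial derivative is jointly continuous, and then
  substituting \<open>z \<bullet> h k\<close> for \<open>t\<close>. Differentiability in
  \<open>z\<close> at the single point \<open>x\<close> suffices as induction hypothesis, since only
  one of the two partial derivatives has to be continuous.\<close>

lemma FCb_infinity_GDERIV:
  assumes "u \<in> FCb_infinity"
  shows "\<exists>d. GDERIV u x :> d"
proof -
  obtain m f h where f: "f \<in> Cb_infinity m" and u: "u = (\<lambda>x. f (\<lambda>i. x \<bullet> h i))"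
    using assms by (rule FCb_infinityE)
  define P where "P k z t = (\<lambda>i. if i < k then z \<bullet> h i else if i = k then t else x \<bullet> h i)"
    for k z and t :: real
  have "\<exists>d. GDERIV (\<lambda>z. f (\<lambda>i. if i < k then z \<bullet> h i else x \<bullet> h i)) x :> d" if "k \<le> m" for k
    using that
  proof (induction k)
    case 0
    show ?case
      using GDERIV_const by auto
  next
    case (Suc k)
    then obtain d where d: "GDERIV (\<lambda>z. f (\<lambda>i. if i < k then z \<bullet> h i else x \<bullet> h i)) x :> d"
      by auto
    have "k < m"
      using Suc.prems by simp
    have P_upd: "P k z t = (P k z s)(k := t)" for z s t
      by (auto simp: P_def)
    have "continuous_on UNIV (\<lambda>q. P k (fst q) (snd q))"
      unfolding P_def
    proof (rule continuous_on_coordinatewise_then_product)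
      fix i
      show "continuous_on UNIV (\<lambda>q. if i < k then fst q \<bullet> h i else if i = k then snd q else x \<bullet> h i)"
        by (cases "i < k"; cases "i = k") (auto intro!: continuous_intros)
    qed
    then have "continuous_on UNIV (\<lambda>q. partial k f (P k (fst q) (snd q)))"
      by (intro continuous_on_compose2[OF Cb_infinity_continuous[OF Cb_infinity_partial[OF f \<open>k < m\<close>]]])
        auto
    then have "continuous_on UNIV (\<lambda>q. blinfun_mult_right (partial k f (P k (fst q) (snd q))))"
      by (rule bounded_linear.continuous_on[OF bounded_linear_blinfun_mult_right])
    then have cont: "continuous (at (x, x \<bullet> h k))
        (\<lambda>(z, t). blinfun_mult_right (partial k f (P k z t)))"
      by (simp only: continuous_on_eq_continuous_at open_UNIV case_prod_beta' UNIV_I)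
    have "((\<lambda>(z, t). f (P k z t)) has_derivative
        (\<lambda>(tz, t). tz \<bullet> d + blinfun_mult_right (partial k f (P k x (x \<bullet> h k))) t))
        (at (x, x \<bullet> h k) within UNIV \<times> UNIV)"
    proof (rule has_derivative_partialsI[where f = "\<lambda>z t. f (P k z t)"
          and fy = "\<lambda>z t. blinfun_mult_right (partial k f (P k z t))"])
      have "P k z (x \<bullet> h k) = (\<lambda>i. if i < k then z \<bullet> h i else x \<bullet> h i)" for z
        by (auto simp: P_def)
      then show "((\<lambda>z. f (P k z (x \<bullet> h k))) has_derivative (\<lambda>tz. tz \<bullet> d)) (at x)"
        using d by (simp add: gderiv_def)
    next
      fix z t
      have "((\<lambda>s. f ((P k z t)(k := s))) has_real_derivative partial k f ((P k z t)(k := t))) (at t)"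
        by (rule Cb_infinity_has_partial[OF f \<open>k < m\<close>])
      then show "((\<lambda>t. f (P k z t)) has_derivative
          blinfun_apply (blinfun_mult_right (partial k f (P k z t)))) (at t)"
        by (simp flip: P_upd add: has_field_derivative_def)
    qed (use cont in auto)
    then have D: "((\<lambda>(z, t). f (P k z t)) has_derivative
        (\<lambda>(tz, t). tz \<bullet> d + partial k f (P k x (x \<bullet> h k)) * t)) (at (x, x \<bullet> h k))"
      by simp
    have "((\<lambda>z. (z, z \<bullet> h k)) has_derivative (\<lambda>tz. (tz, tz \<bullet> h k))) (at x)"
      by (intro has_derivative_Pair has_derivative_ident has_derivative_inner_left)
    from has_derivative_compose[OF this D]
    have "((\<lambda>z. f (P k z (z \<bullet> h k))) has_derivative
        (\<lambda>tz. tz \<bullet> d + partial k f (P k x (x \<bullet> h k)) * (tz \<bullet> h k))) (at x)"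
      by simp
    moreover have "P k z (z \<bullet> h k) = (\<lambda>i. if i < Suc k then z \<bullet> h i else x \<bullet> h i)" for z
      by (auto simp: P_def less_Suc_eq)
    ultimately have "GDERIV (\<lambda>z. f (\<lambda>i. if i < Suc k then z \<bullet> h i else x \<bullet> h i)) x :>
        d + partial k f (P k x (x \<bullet> h k)) *\<^sub>R h k"
      by (simp add: gderiv_def inner_add_right)
    then show ?case ..
  qed
  moreover have "f (\<lambda>i. if i < m then z \<bullet> h i else x \<bullet> h i) = f (\<lambda>i. z \<bullet> h i)" for z
    by (intro Cb_infinity_cong[OF f]) simp
  ultimately show ?thesis
    by (metis (no_types, lifting) ext order_refl u)
qed

lemma GDERIV_unique:
  assumes "GDERIV u x :> d" "GDERIV u x :> d'"
  shows "d = d'"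
proof (rule vector_eq_ldot[THEN iffD1], rule allI)
  fix z
  show "z \<bullet> d = z \<bullet> d'"
    using fun_cong[OF has_derivative_unique[OF assms[unfolded gderiv_def]]] .
qed

lemma GDERIV_grad:
  assumes "u \<in> FCb_infinity"
  shows "GDERIV u x :> grad u x"
proof -
  obtain d where d: "GDERIV u x :> d"
    using FCb_infinity_GDERIV[OF assms] by blast
  from d show ?thesis
    unfolding grad_def by (rule theI) (rule GDERIV_unique[OF _ d])
qed

lemma grad_eqI:
  assumes "GDERIV u x :> d"
  shows "grad u x = d"
  unfolding grad_def using assms by (rule the_equality) (rule GDERIV_unique[OF _ assms])

lemma grad_diff:
  assumes "u \<in> FCb_infinity" "v \<in> FCb_infinity"
  shows "grad (\<lambda>x. u x - v x) x = grad u x - grad v x"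
  using assms by (intro grad_eqI GDERIV_diff GDERIV_grad)

lemma grad_scale:
  assumes "u \<in> FCb_infinity"
  shows "grad (\<lambda>x. c * u x) x = c *\<^sub>R grad u x"
proof (rule grad_eqI)
  show "GDERIV (\<lambda>x. c * u x) x :> c *\<^sub>R grad u x"
    using has_derivative_mult_right[OF GDERIV_grad[OF assms, of x, unfolded gderiv_def], of c]
    by (simp add: gderiv_def)
qed

section \<open>Semi-inner products, \<open>L\<^sup>2\<close> and the closure of the pre-form\<close>

text \<open>Covers both the inner product on square-integrable functions and the pre-form on
  cylinder functions. These are sets of functions rather than types, hence the carrier
  \<open>V\<close>. \<open>B\<close> is only semidefinite: functions are not identified up to null
  sets, and the pre-form vanishes on constants.\<close>

locale semi_inner =
  fixes V :: "('a \<Rightarrow> real) set" and B :: "('a \<Rightarrow> real) \<Rightarrow> ('a \<Rightarrow> real) \<Rightarrow> real"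
  assumes diff_mem: "u \<in> V \<Longrightarrow> v \<in> V \<Longrightarrow> (\<lambda>x. u x - v x) \<in> V"
    and scale_mem: "u \<in> V \<Longrightarrow> (\<lambda>x. c * u x) \<in> V"
    and sym: "B u v = B v u"
    and diff_left: "u \<in> V \<Longrightarrow> v \<in> V \<Longrightarrow> w \<in> V \<Longrightarrow> B (\<lambda>x. u x - v x) w = B u w - B v w"
    and scale_left: "u \<in> V \<Longrightarrow> w \<in> V \<Longrightarrow> B (\<lambda>x. c * u x) w = c * B u w"
    and nonneg: "u \<in> V \<Longrightarrow> 0 \<le> B u u"
begin

lemma diff_right: "u \<in> V \<Longrightarrow> v \<in> V \<Longrightarrow> w \<in> V \<Longrightarrow> B w (\<lambda>x. u x - v x) = B w u - B w v"
  using diff_left[of u v w] by (simp add: sym[of w])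

lemma scale_right: "u \<in> V \<Longrightarrow> w \<in> V \<Longrightarrow> B w (\<lambda>x. c * u x) = c * B w u"
  using scale_left[of u w c] by (simp add: sym[of w])

lemma diff_self:
  "u \<in> V \<Longrightarrow> v \<in> V \<Longrightarrow> B (\<lambda>x. u x - v x) (\<lambda>x. u x - v x) = B u u - 2 * B u v + B v v"
  by (simp add: diff_left diff_right diff_mem sym[of v u])

lemma Cauchy_Schwarz:
  assumes "u \<in> V" "v \<in> V"
  shows "\<bar>B u v\<bar> \<le> sqrt (B u u) * sqrt (B v v)"
proof -
  have quad: "0 \<le> B u u - 2 * t * B u v + t\<^sup>2 * B v v" for t
    using nonneg[OF diff_mem[OF assms(1) scale_mem[OF assms(2), of t]]] assms
    by (simp add: diff_self scale_left scale_right scale_mem power2_eq_square mult.assoc)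
  have "(B u v)\<^sup>2 \<le> B u u * B v v"
  proof (cases "B v v = 0")
    case True
    have "B u v = 0"
    proof (rule ccontr)
      assume "B u v \<noteq> 0"
      \<comment> \<open>With \<open>B v v = 0\<close> the quadratic is affine in t, and this t gives
        it the value -1.\<close>
      then show False
        using quad[of "(B u u + 1) / (2 * B u v)"] True by simp
    qed
    then show ?thesis
      using True by simp
  next
    case False
    then have "B v v > 0"
      using nonneg[OF assms(2)] by simp
    \<comment> \<open>The quadratic at its minimiser.\<close>
    moreover have "0 \<le> B u u - (B u v)\<^sup>2 / B v v"
      using quad[of "B u v / B v v"] False by (simp add: power2_eq_square field_simps)
    ultimately show ?thesis
      by (simp add: field_simps)
  qed
  then have "sqrt ((B u v)\<^sup>2) \<le> sqrt (B u u * B v v)"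
    by (rule real_sqrt_le_mono)
  then show ?thesis
    by (simp add: real_sqrt_mult)
qed

lemma norm_reverse_triangle:
  assumes "u \<in> V" "v \<in> V"
  shows "\<bar>sqrt (B u u) - sqrt (B v v)\<bar> \<le> sqrt (B (\<lambda>x. u x - v x) (\<lambda>x. u x - v x))"
proof (rule real_le_rsqrt)
  have "\<bar>sqrt (B u u) - sqrt (B v v)\<bar>\<^sup>2 = B u u - 2 * (sqrt (B u u) * sqrt (B v v)) + B v v"
    using nonneg assms by (simp add: power2_diff)
  also have "\<dots> \<le> B u u - 2 * B u v + B v v"
    using Cauchy_Schwarz[OF assms] by simp
  finally show "\<bar>sqrt (B u u) - sqrt (B v v)\<bar>\<^sup>2 \<le> B (\<lambda>x. u x - v x) (\<lambda>x. u x - v x)"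
    using assms by (simp add: diff_self)
qed

lemma norm_diff_le:
  assumes "u \<in> V" "v \<in> V"
  shows "sqrt (B (\<lambda>x. u x - v x) (\<lambda>x. u x - v x)) \<le> sqrt (B u u) + sqrt (B v v)"
proof (rule real_le_lsqrt)
  have "B (\<lambda>x. u x - v x) (\<lambda>x. u x - v x) \<le> B u u + 2 * (sqrt (B u u) * sqrt (B v v)) + B v v"
    using Cauchy_Schwarz[OF assms] assms by (simp add: diff_self abs_le_iff)
  also have "\<dots> = (sqrt (B u u) + sqrt (B v v))\<^sup>2"
    using nonneg assms by (simp add: power2_sum)
  finally show "B (\<lambda>x. u x - v x) (\<lambda>x. u x - v x) \<le> (sqrt (B u u) + sqrt (B v v))\<^sup>2" .
qed (use nonneg assms in simp)

end

section \<open>Square-integrable functions\<close>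

lemma L2_space_integrable_mult:
  assumes "f \<in> L2_space \<nu>" "g \<in> L2_space \<nu>"
  shows "integrable \<nu> (\<lambda>x. f x * g x)"
proof (rule Bochner_Integration.integrable_bound)
  show "integrable \<nu> (\<lambda>x. (f x)\<^sup>2 + (g x)\<^sup>2)"
    using assms by (simp add: L2_space_def)
  show "(\<lambda>x. f x * g x) \<in> borel_measurable \<nu>"
    using assms by (auto simp: L2_space_def)
  have "\<bar>f x * g x\<bar> \<le> (f x)\<^sup>2 + (g x)\<^sup>2" for x
  proof -
    have "2 * (\<bar>f x\<bar> * \<bar>g x\<bar>) \<le> (f x)\<^sup>2 + (g x)\<^sup>2"
      using sum_squares_bound[of "\<bar>f x\<bar>" "\<bar>g x\<bar>"] by simp
    moreover have "0 \<le> \<bar>f x\<bar> * \<bar>g x\<bar>"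
      by simp
    ultimately show ?thesis
      unfolding abs_mult by linarith
  qed
  then show "AE x in \<nu>. norm (f x * g x) \<le> norm ((f x)\<^sup>2 + (g x)\<^sup>2)"
    by simp
qed

interpretation L2: semi_inner "L2_space \<nu>" "L2_inner \<nu>" for \<nu> :: "'a measure"
proof
  fix u v w :: "'a \<Rightarrow> real" and c :: real
  assume u: "u \<in> L2_space \<nu>"
  then have "integrable \<nu> (\<lambda>x. c\<^sup>2 * (u x)\<^sup>2)"
    by (simp add: L2_space_def)
  then show "(\<lambda>x. c * u x) \<in> L2_space \<nu>"
    using u by (auto simp: L2_space_def power_mult_distrib)
  show "0 \<le> L2_inner \<nu> u u"
    by (simp add: L2_inner_def)
  show "L2_inner \<nu> (\<lambda>x. c * u x) w = c * L2_inner \<nu> u w" if "w \<in> L2_space \<nu>"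
    by (simp add: L2_inner_def mult.assoc)
  assume v: "v \<in> L2_space \<nu>"
  have "integrable \<nu> (\<lambda>x. (u x)\<^sup>2 + (v x)\<^sup>2 - 2 * (u x * v x))"
    using u v L2_space_integrable_mult[OF u v]
    by (intro Bochner_Integration.integrable_diff Bochner_Integration.integrable_add
        integrable_mult_right) (auto simp: L2_space_def)
  then show "(\<lambda>x. u x - v x) \<in> L2_space \<nu>"
    using u v by (auto simp: L2_space_def power2_diff mult.assoc)
  show "L2_inner \<nu> (\<lambda>x. u x - v x) w = L2_inner \<nu> u w - L2_inner \<nu> v w" if "w \<in> L2_space \<nu>"
    using L2_space_integrable_mult[OF u that] L2_space_integrable_mult[OF v that]
    by (simp add: L2_inner_def left_diff_distrib)
qed (simp add: L2_inner_def mult.commute)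

lemma L2_norm_nonneg: "0 \<le> L2_norm \<nu> f"
  by (simp add: L2_norm_def L2_inner_def)

lemma L2_norm_minus_commute: "L2_norm \<nu> (\<lambda>x. f x - g x) = L2_norm \<nu> (\<lambda>x. g x - f x)"
  by (simp add: L2_norm_def L2_inner_def flip: power2_eq_square)
    (simp add: power2_commute[of "f _"])

lemma L2_norm_triangle:
  assumes "f \<in> L2_space \<nu>" "g \<in> L2_space \<nu>"
  shows "L2_norm \<nu> g \<le> L2_norm \<nu> (\<lambda>x. f x - g x) + L2_norm \<nu> f"
  using L2.norm_reverse_triangle[OF assms] by (simp add: L2_norm_def abs_le_iff)

lemma L2_norm_scale: "L2_norm \<nu> (\<lambda>x. c * f x) = \<bar>c\<bar> * L2_norm \<nu> f"
proof -
  have "L2_inner \<nu> (\<lambda>x. c * f x) (\<lambda>x. c * f x) = c\<^sup>2 * L2_inner \<nu> f f"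
    by (simp add: L2_inner_def power2_eq_square mult_ac)
  then show ?thesis
    by (simp add: L2_norm_def real_sqrt_mult)
qed

lemma bounded_continuous_L2_space:
  fixes u :: "'h::topological_space \<Rightarrow> real"
  assumes "finite_measure \<nu>" "sets \<nu> = sets borel" "continuous_on UNIV u" "bounded (range u)"
  shows "u \<in> L2_space \<nu>"
proof -
  obtain A where A: "\<And>x. \<bar>u x\<bar> \<le> A"
    using assms(4) by (auto simp: bounded_iff)
  have meas: "u \<in> borel_measurable \<nu>"
    using borel_measurable_continuous_onI[OF assms(3)] assms(2) measurable_cong_sets by blast
  have "(u x)\<^sup>2 \<le> A\<^sup>2" for x
    using power_mono[OF A, of x 2] by simp
  then have "integrable \<nu> (\<lambda>x. (u x)\<^sup>2)"
    using meas by (intro finite_measure.integrable_const_bound[OF assms(1), of _ "A\<^sup>2"]) auto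
  with meas show ?thesis
    by (simp add: L2_space_def)
qed

lemma FCb_infinity_L2_space:
  assumes "finite_measure \<nu>" "sets \<nu> = sets borel" "u \<in> FCb_infinity"
  shows "u \<in> L2_space \<nu>"
  using assms FCb_infinity_continuous FCb_infinity_bounded by (intro bounded_continuous_L2_space)

section \<open>The pre-form and its closure\<close>

lemma Gamma_sym: "Gamma Q D u v x = Gamma Q D v u x"
  by (simp add: Gamma_def inner_commute)

lemma Gamma_diff_left:
  assumes "u \<in> FCb_infinity" "v \<in> FCb_infinity"
  shows "Gamma Q D (\<lambda>x. u x - v x) w x = Gamma Q D u w x - Gamma Q D v w x"
  using assms by (simp add: Gamma_def grad_diff blinfun.diff_right inner_diff_left)

lemma Gamma_scale_left:
  assumes "u \<in> FCb_infinity"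
  shows "Gamma Q D (\<lambda>x. c * u x) w x = c * Gamma Q D u w x"
  using assms by (simp add: Gamma_def grad_scale blinfun.scaleR_right)

lemma semi_inner_pre_form:
  assumes "closable_form Q D \<nu>"
  shows "semi_inner FCb_infinity (pre_form Q D \<nu>)"
proof
  have int: "integrable \<nu> (Gamma Q D u w)" if "u \<in> FCb_infinity" "w \<in> FCb_infinity" for u w
    using that assms by (simp add: closable_form_def)
  fix u v w :: "'a \<Rightarrow> real" and c :: real
  show "pre_form Q D \<nu> u v = pre_form Q D \<nu> v u"
    using Gamma_sym[of Q D u v] by (simp add: pre_form_def)
  assume u: "u \<in> FCb_infinity"
  show "(\<lambda>x. c * u x) \<in> FCb_infinity"
    using u by (rule FCb_infinity_scale)
  show "0 \<le> pre_form Q D \<nu> u u"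
    by (simp add: pre_form_def Gamma_def)
  show "pre_form Q D \<nu> (\<lambda>x. c * u x) w = c * pre_form Q D \<nu> u w" if "w \<in> FCb_infinity"
    using u by (simp add: pre_form_def Gamma_scale_left)
  assume v: "v \<in> FCb_infinity"
  show "(\<lambda>x. u x - v x) \<in> FCb_infinity"
    using u v by (rule FCb_infinity_diff)
  show "pre_form Q D \<nu> (\<lambda>x. u x - v x) w = pre_form Q D \<nu> u w - pre_form Q D \<nu> v w"
    if "w \<in> FCb_infinity"
    using u v int[OF u that] int[OF v that] by (simp add: pre_form_def Gamma_diff_left)
qed

text \<open>Closability speaks only of sequences approximating 0. The difference of two sequences
  with the same limit is one of these, which is how closability compares their energies.\<close>

lemma approximating_diff:
  assumes fin: "finite_measure \<nu>" and borel: "sets \<nu> = sets borel" and cl: "closable_form Q D \<nu>"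
    and u: "approximating Q D \<nu> u f" and v: "approximating Q D \<nu> v f"
  shows "approximating Q D \<nu> (\<lambda>k x. u k x - v k x) (\<lambda>_. 0)"
proof -
  interpret E: semi_inner FCb_infinity "pre_form Q D \<nu>"
    using cl by (rule semi_inner_pre_form)
  let ?E = "\<lambda>w. pre_form Q D \<nu> w w"
  have FC: "u k \<in> FCb_infinity" "v k \<in> FCb_infinity" for k
    using u v by (auto simp: approximating_def)
  have f: "f \<in> L2_space \<nu>"
    using u by (simp add: approximating_def)
  note L2 = FCb_infinity_L2_space[OF fin borel]
  have "(\<lambda>k. L2_norm \<nu> (\<lambda>x. u k x - v k x)) \<longlonglongrightarrow> 0"
  proof (rule Lim_null_comparison)
    have "L2_norm \<nu> (\<lambda>x. u k x - v k x) \<le> L2_norm \<nu> (\<lambda>x. u k x - f x) + L2_norm \<nu> (\<lambda>x. v k x - f x)" for k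
      using L2.norm_diff_le[of "\<lambda>x. u k x - f x" \<nu> "\<lambda>x. v k x - f x"]
        L2.diff_mem[OF L2[OF FC(1)] f] L2.diff_mem[OF L2[OF FC(2)] f] by (simp add: L2_norm_def)
    then show "\<forall>\<^sub>F k in sequentially. norm (L2_norm \<nu> (\<lambda>x. u k x - v k x)) \<le>
        L2_norm \<nu> (\<lambda>x. u k x - f x) + L2_norm \<nu> (\<lambda>x. v k x - f x)"
      by (simp add: L2_norm_nonneg)
    show "(\<lambda>k. L2_norm \<nu> (\<lambda>x. u k x - f x) + L2_norm \<nu> (\<lambda>x. v k x - f x)) \<longlonglongrightarrow> 0"
      using u v by (auto simp: approximating_def intro: tendsto_add_zero)
  qed
  moreover have "\<exists>N. \<forall>i\<ge>N. \<forall>j\<ge>N.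
      ?E (\<lambda>x. (u i x - v i x) - (u j x - v j x)) < e" if "e > 0" for e
  proof -
    \<comment> \<open>The quarter comes from adding square roots: (sqrt (e / 4) + sqrt (e / 4))^2 =
      e.\<close>
    obtain M N where M: "\<And>i j. i \<ge> M \<Longrightarrow> j \<ge> M \<Longrightarrow> ?E (\<lambda>x. u i x - u j x) < e / 4"
      and N: "\<And>i j. i \<ge> N \<Longrightarrow> j \<ge> N \<Longrightarrow> ?E (\<lambda>x. v i x - v j x) < e / 4"
      using u v \<open>e > 0\<close> unfolding approximating_def by (meson zero_less_divide_iff zero_less_numeral)
    have "?E (\<lambda>x. (u i x - v i x) - (u j x - v j x)) < e" if "i \<ge> max M N" "j \<ge> max M N" for i j
    proof -
      have eq: "(\<lambda>x. (u i x - v i x) - (u j x - v j x)) = (\<lambda>x. (u i x - u j x) - (v i x - v j x))"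
        by auto
      have "?E (\<lambda>x. (u i x - u j x) - (v i x - v j x)) \<le>
          (sqrt (?E (\<lambda>x. u i x - u j x)) + sqrt (?E (\<lambda>x. v i x - v j x)))\<^sup>2"
        using E.norm_diff_le[OF E.diff_mem[OF FC(1) FC(1), of i j] E.diff_mem[OF FC(2) FC(2), of i j]]
        by (rule sqrt_le_D)
      also have "\<dots> < (sqrt (e / 4) + sqrt (e / 4))\<^sup>2"
        using M[of i j] N[of i j] that E.nonneg[OF E.diff_mem[OF FC(1) FC(1), of i j]]
          E.nonneg[OF E.diff_mem[OF FC(2) FC(2), of i j]]
        by (intro power_strict_mono add_strict_mono) auto
      also have "\<dots> = e"
        using \<open>e > 0\<close> by (simp add: power2_sum)
      finally show ?thesis
        by (simp add: eq)
    qed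
    then show ?thesis
      by blast
  qed
  ultimately show ?thesis
    using FCb_infinity_diff[OF FC] by (simp add: approximating_def L2_space_def)
qed

text \<open>Two independent sequences appear because \<open>form\<close> quantifies over one for
  each argument, even on the diagonal. The seminorms along one sequence converge by the reverse
  triangle inequality, and closability makes their limit \<open>l\<close> common to all sequences.
  Then B(u, v) = B(u, u) - B(u, u - v), where the last term vanishes by Cauchy-Schwarz, so the limit
  is l^2.\<close>

lemma approximating_pre_form_limit:
  assumes fin: "finite_measure \<nu>" and borel: "sets \<nu> = sets borel" and cl: "closable_form Q D \<nu>"
    and w: "approximating Q D \<nu> w f"
  obtains c where "\<And>u v. approximating Q D \<nu> u f \<Longrightarrow> approximating Q D \<nu> v f \<Longrightarrow>
    (\<lambda>k. pre_form Q D \<nu> (u k) (v k)) \<longlonglongrightarrow> c"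
proof -
  interpret E: semi_inner FCb_infinity "pre_form Q D \<nu>"
    using cl by (rule semi_inner_pre_form)
  let ?N = "\<lambda>w. sqrt (pre_form Q D \<nu> w w)"
  have FC: "u k \<in> FCb_infinity" if "approximating Q D \<nu> u f" for u k
    using that by (simp add: approximating_def)
  have diff: "(\<lambda>k. ?N (\<lambda>x. u k x - v k x)) \<longlonglongrightarrow> 0"
    if u: "approximating Q D \<nu> u f" and v: "approximating Q D \<nu> v f" for u v
    using cl approximating_diff[OF fin borel cl u v] tendsto_real_sqrt
    unfolding closable_form_def by fastforce
  have "Cauchy (\<lambda>k. ?N (w k))"
  proof (rule metric_CauchyI)
    fix e :: real assume "e > 0"
    then have "e\<^sup>2 > 0"
      by simp
    then obtain M where M: "\<And>i j. i \<ge> M \<Longrightarrow> j \<ge> M \<Longrightarrow>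
        pre_form Q D \<nu> (\<lambda>x. w i x - w j x) (\<lambda>x. w i x - w j x) < e\<^sup>2"
      using w unfolding approximating_def by meson
    have "dist (?N (w i)) (?N (w j)) < e" if "i \<ge> M" "j \<ge> M" for i j
    proof -
      have "?N (\<lambda>x. w i x - w j x) < e"
        using M[OF that] \<open>e > 0\<close> by (simp add: real_sqrt_less_iff real_less_lsqrt)
      then show ?thesis
        using E.norm_reverse_triangle[OF FC[OF w] FC[OF w], of i j] by (simp add: dist_real_def)
    qed
    then show "\<exists>M. \<forall>i\<ge>M. \<forall>j\<ge>M. dist (?N (w i)) (?N (w j)) < e"
      by blast
  qed
  then obtain l where l: "(\<lambda>k. ?N (w k)) \<longlonglongrightarrow> l"
    using Cauchy_convergent convergent_def by blast
  have N: "(\<lambda>k. ?N (u k)) \<longlonglongrightarrow> l" if u: "approximating Q D \<nu> u f" for u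
  proof -
    have "(\<lambda>k. ?N (u k) - ?N (w k)) \<longlonglongrightarrow> 0"
      using E.norm_reverse_triangle[OF FC[OF u] FC[OF w]]
      by (intro Lim_null_comparison[OF _ diff[OF u w]]) simp
    from tendsto_add[OF this l] show ?thesis
      by simp
  qed
  show thesis
  proof (rule that[of "l\<^sup>2"])
    fix u v
    assume u: "approximating Q D \<nu> u f" and v: "approximating Q D \<nu> v f"
    have "(\<lambda>k. pre_form Q D \<nu> (u k) (\<lambda>x. u k x - v k x)) \<longlonglongrightarrow> 0"
    proof (rule Lim_null_comparison)
      show "\<forall>\<^sub>F k in sequentially. norm (pre_form Q D \<nu> (u k) (\<lambda>x. u k x - v k x)) \<le>
          ?N (u k) * ?N (\<lambda>x. u k x - v k x)"
        using E.Cauchy_Schwarz[OF FC[OF u] E.diff_mem[OF FC[OF u] FC[OF v]]] by simp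
      show "(\<lambda>k. ?N (u k) * ?N (\<lambda>x. u k x - v k x)) \<longlonglongrightarrow> 0"
        using tendsto_mult[OF N[OF u] diff[OF u v]] by simp
    qed
    from tendsto_diff[OF tendsto_power[OF N[OF u], of 2] this]
    show "(\<lambda>k. pre_form Q D \<nu> (u k) (v k)) \<longlonglongrightarrow> l\<^sup>2"
      using E.nonneg[OF FC[OF u]] by (simp add: E.diff_right FC[OF u] FC[OF v])
  qed
qed

lemma pre_form_tendsto_form:
  assumes fin: "finite_measure \<nu>" and borel: "sets \<nu> = sets borel" and cl: "closable_form Q D \<nu>"
    and u: "approximating Q D \<nu> u f"
  shows "(\<lambda>k. pre_form Q D \<nu> (u k) (u k)) \<longlonglongrightarrow> form Q D \<nu> f f"
proof -
  obtain c where c: "\<And>u v. approximating Q D \<nu> u f \<Longrightarrow> approximating Q D \<nu> v f \<Longrightarrow>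
      (\<lambda>k. pre_form Q D \<nu> (u k) (v k)) \<longlonglongrightarrow> c"
    using approximating_pre_form_limit[OF fin borel cl u] by blast
  have "form Q D \<nu> f f = c"
    unfolding form_def using c LIMSEQ_unique[OF c[OF u u]] u by (intro the_equality) blast+
  then show ?thesis
    using c[OF u u] by simp
qed

lemma form_scale:
  assumes fin: "finite_measure \<nu>" and borel: "sets \<nu> = sets borel" and cl: "closable_form Q D \<nu>"
    and f: "f \<in> form_dom Q D \<nu>"
  shows "(\<lambda>x. c * f x) \<in> form_dom Q D \<nu>"
    and "form Q D \<nu> (\<lambda>x. c * f x) (\<lambda>x. c * f x) = c\<^sup>2 * form Q D \<nu> f f"
proof -
  interpret E: semi_inner FCb_infinity "pre_form Q D \<nu>"
    using cl by (rule semi_inner_pre_form)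
  obtain u where u: "approximating Q D \<nu> u f"
    using f by (auto simp: form_dom_def)
  have FC: "u k \<in> FCb_infinity" for k
    using u by (simp add: approximating_def)
  have scale: "pre_form Q D \<nu> (\<lambda>x. c * w x) (\<lambda>x. c * w x) = c\<^sup>2 * pre_form Q D \<nu> w w"
    if "w \<in> FCb_infinity" for w
    using that by (simp add: E.scale_left E.scale_right E.scale_mem power2_eq_square)
  have "approximating Q D \<nu> (\<lambda>k x. c * u k x) (\<lambda>x. c * f x)"
    unfolding approximating_def
  proof (intro conjI allI impI)
    show "(\<lambda>x. c * u k x) \<in> FCb_infinity" for k
      using FC by (rule FCb_infinity_scale)
    show "(\<lambda>x. c * f x) \<in> L2_space \<nu>"
      using u by (simp add: approximating_def L2.scale_mem)
    have "(\<lambda>k. \<bar>c\<bar> * L2_norm \<nu> (\<lambda>x. u k x - f x)) \<longlonglongrightarrow> 0"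
      using u by (simp add: approximating_def tendsto_mult_right_zero)
    then show "(\<lambda>k. L2_norm \<nu> (\<lambda>x. c * u k x - c * f x)) \<longlonglongrightarrow> 0"
      by (simp flip: right_diff_distrib add: L2_norm_scale)
    fix e :: real assume "e > 0"
    \<comment> \<open>Dividing by \<open>c\<^sup>2 + 1\<close> rather than \<open>c\<^sup>2\<close>
      covers \<open>c = 0\<close>.\<close>
    then have "e / (c\<^sup>2 + 1) > 0"
      by (simp add: add_nonneg_pos)
    then obtain N where N: "\<And>i j. i \<ge> N \<Longrightarrow> j \<ge> N \<Longrightarrow>
        pre_form Q D \<nu> (\<lambda>x. u i x - u j x) (\<lambda>x. u i x - u j x) < e / (c\<^sup>2 + 1)"
      using u unfolding approximating_def by meson
    have "pre_form Q D \<nu> (\<lambda>x. c * u i x - c * u j x) (\<lambda>x. c * u i x - c * u j x) < e"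
      if "i \<ge> N" "j \<ge> N" for i j
    proof -
      let ?w = "\<lambda>x. u i x - u j x"
      have "?w \<in> FCb_infinity"
        using FC FC by (rule FCb_infinity_diff)
      then have "c\<^sup>2 * pre_form Q D \<nu> ?w ?w \<le> (c\<^sup>2 + 1) * pre_form Q D \<nu> ?w ?w"
        using E.nonneg by (intro mult_right_mono) auto
      also have "\<dots> < e"
        using N[OF that] by (simp add: pos_less_divide_eq add_nonneg_pos mult.commute)
      finally show ?thesis
        using scale[OF \<open>?w \<in> FCb_infinity\<close>] by (simp add: right_diff_distrib)
    qed
    then show "\<exists>N. \<forall>i\<ge>N. \<forall>j\<ge>N.
        pre_form Q D \<nu> (\<lambda>x. c * u i x - c * u j x) (\<lambda>x. c * u i x - c * u j x) < e"
      by blast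
  qed
  note cu = this
  show "(\<lambda>x. c * f x) \<in> form_dom Q D \<nu>"
    using cu by (auto simp: form_dom_def)
  have "(\<lambda>k. c\<^sup>2 * pre_form Q D \<nu> (u k) (u k)) \<longlonglongrightarrow>
      form Q D \<nu> (\<lambda>x. c * f x) (\<lambda>x. c * f x)"
    using pre_form_tendsto_form[OF fin borel cl cu] scale[OF FC] by simp
  moreover have "(\<lambda>k. c\<^sup>2 * pre_form Q D \<nu> (u k) (u k)) \<longlonglongrightarrow> c\<^sup>2 * form Q D \<nu> f f"
    using pre_form_tendsto_form[OF fin borel cl u] by (rule tendsto_mult_left)
  ultimately show "form Q D \<nu> (\<lambda>x. c * f x) (\<lambda>x. c * f x) = c\<^sup>2 * form Q D \<nu> f f"
    by (rule LIMSEQ_unique)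
qed

section \<open>Convergence along varying \<open>L\<^sup>2\<close> spaces\<close>

lemma bounded_range_mult:
  fixes a b :: "'a \<Rightarrow> real"
  assumes "bounded (range a)" "bounded (range b)"
  shows "bounded (range (\<lambda>x. a x * b x))"
proof -
  obtain A B where AB: "\<And>x. \<bar>a x\<bar> \<le> A" "\<And>x. \<bar>b x\<bar> \<le> B"
    using assms unfolding bounded_iff by auto
  have "\<bar>a x * b x\<bar> \<le> A * B" for x
    unfolding abs_mult using AB[of x] by (intro mult_mono) auto
  then show ?thesis
    unfolding bounded_iff by auto
qed

lemma L2_space_bounded_mult:
  assumes "f \<in> L2_space \<nu>" "\<psi> \<in> borel_measurable \<nu>" "\<And>x. \<bar>\<psi> x\<bar> \<le> M"
  shows "(\<lambda>x. \<psi> x * f x) \<in> L2_space \<nu>"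
    and "L2_norm \<nu> (\<lambda>x. \<psi> x * f x) \<le> M * L2_norm \<nu> f"
proof -
  have M: "0 \<le> M"
    using assms(3)[of undefined] by simp
  have f: "f \<in> borel_measurable \<nu>" "integrable \<nu> (\<lambda>x. M\<^sup>2 * (f x)\<^sup>2)"
    using assms(1) by (auto simp: L2_space_def)
  have le: "(\<psi> x * f x)\<^sup>2 \<le> M\<^sup>2 * (f x)\<^sup>2" for x
    using power_mono[OF assms(3)[of x], of 2] by (simp add: power_mult_distrib mult_right_mono)
  have int: "integrable \<nu> (\<lambda>x. (\<psi> x * f x)\<^sup>2)"
    using f assms(2) le by (intro Bochner_Integration.integrable_bound[OF f(2)]) auto
  then show "(\<lambda>x. \<psi> x * f x) \<in> L2_space \<nu>"
    using f assms(2) by (auto simp: L2_space_def)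
  have "L2_inner \<nu> (\<lambda>x. \<psi> x * f x) (\<lambda>x. \<psi> x * f x) \<le> (\<integral>x. M\<^sup>2 * (f x)\<^sup>2 \<partial>\<nu>)"
    unfolding L2_inner_def using int f(2) le
    by (intro integral_mono) (auto simp: power2_eq_square)
  also have "\<dots> = M\<^sup>2 * L2_inner \<nu> f f"
    by (simp add: L2_inner_def power2_eq_square)
  finally show "L2_norm \<nu> (\<lambda>x. \<psi> x * f x) \<le> M * L2_norm \<nu> f"
    using M real_sqrt_le_mono by (fastforce simp: L2_norm_def real_sqrt_mult)
qed

text \<open>The factors are exchanged one at a time, from f g via \<phi> g to \<phi> \<eta>, with
  Cauchy-Schwarz each time. The first exchange costs at most 2 M R \<delta>, because the norm of g
  is at most R + \<delta> \<le> 2 R; the second costs M R \<delta>. The bound \<open>R\<close> is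
  imposed on \<phi> and \<eta>, not on f and g, because under the varying measures it is the norms
  of fixed cylinder functions that weak convergence controls.\<close>

lemma integral_mult_diff_bound:
  assumes f: "f \<in> L2_space \<nu>" and g: "g \<in> L2_space \<nu>"
    and \<phi>: "\<phi> \<in> L2_space \<nu>" and \<eta>: "\<eta> \<in> L2_space \<nu>"
    and \<psi>: "\<psi> \<in> borel_measurable \<nu>" "\<And>x. \<bar>\<psi> x\<bar> \<le> M"
    and close: "L2_norm \<nu> (\<lambda>x. \<phi> x - f x) \<le> \<delta>" "L2_norm \<nu> (\<lambda>x. \<eta> x - g x) \<le> \<delta>"
    and R: "L2_norm \<nu> \<phi> \<le> R" "L2_norm \<nu> \<eta> \<le> R" and "\<delta> \<le> R"
  shows "\<bar>(\<integral>x. \<psi> x * f x * g x \<partial>\<nu>) - (\<integral>x. \<psi> x * \<phi> x * \<eta> x \<partial>\<nu>)\<bar> \<le> M * (3 * R * \<delta>)"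
proof -
  have M: "0 \<le> M"
    using \<psi>(2)[of undefined] by simp
  have \<delta>: "0 \<le> \<delta>"
    using close(1) L2_norm_nonneg order_trans by blast
  have R0: "0 \<le> R"
    using R(1) L2_norm_nonneg order_trans by blast
  let ?I = "L2_inner \<nu>"
  note \<psi>m = L2_space_bounded_mult[OF _ \<psi>]
  have d1: "(\<lambda>x. \<phi> x - f x) \<in> L2_space \<nu>" and d2: "(\<lambda>x. \<eta> x - g x) \<in> L2_space \<nu>"
    using f g \<phi> \<eta> by (auto intro: L2.diff_mem)
  have CS: "\<bar>?I (\<lambda>x. \<psi> x * a x) b\<bar> \<le> M * L2_norm \<nu> a * L2_norm \<nu> b"
    if "a \<in> L2_space \<nu>" "b \<in> L2_space \<nu>" for a b
  proof -
    have "\<bar>?I (\<lambda>x. \<psi> x * a x) b\<bar> \<le> L2_norm \<nu> (\<lambda>x. \<psi> x * a x) * L2_norm \<nu> b"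
      using L2.Cauchy_Schwarz[OF \<psi>m(1)[OF that(1)] that(2)] by (simp add: L2_norm_def)
    also have "\<dots> \<le> M * L2_norm \<nu> a * L2_norm \<nu> b"
      using \<psi>m(2)[OF that(1)] L2_norm_nonneg by (rule mult_right_mono)
    finally show ?thesis .
  qed
  have int: "integrable \<nu> (\<lambda>x. \<psi> x * a x * b x)" if "a \<in> L2_space \<nu>" "b \<in> L2_space \<nu>" for a b
    using L2_space_integrable_mult[OF \<psi>m(1)[OF that(1)] that(2)] .
  have "(\<integral>x. \<psi> x * f x * g x \<partial>\<nu>) - (\<integral>x. \<psi> x * \<phi> x * \<eta> x \<partial>\<nu>) =
      - ?I (\<lambda>x. \<psi> x * (\<phi> x - f x)) g - ?I (\<lambda>x. \<psi> x * \<phi> x) (\<lambda>x. \<eta> x - g x)"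
    using Bochner_Integration.integral_diff[OF int[OF \<phi> g] int[OF f g]]
      Bochner_Integration.integral_diff[OF int[OF \<phi> \<eta>] int[OF \<phi> g]]
    by (simp add: L2_inner_def left_diff_distrib right_diff_distrib)
  also have "\<bar>\<dots>\<bar> \<le> M * L2_norm \<nu> (\<lambda>x. \<phi> x - f x) * L2_norm \<nu> g +
      M * L2_norm \<nu> \<phi> * L2_norm \<nu> (\<lambda>x. \<eta> x - g x)"
    using CS[OF d1 g] CS[OF \<phi> d2] by linarith
  also have "\<dots> \<le> M * \<delta> * (2 * R) + M * R * \<delta>"
  proof -
    have "L2_norm \<nu> g \<le> 2 * R"
      using L2_norm_triangle[OF \<eta> g] close(2) R(2) \<open>\<delta> \<le> R\<close> by linarith
    then show ?thesis
      using close R M \<delta> R0 L2_norm_nonneg by (intro add_mono mult_mono) auto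
  qed
  finally show ?thesis
    by (simp add: algebra_simps)
qed

text \<open>One fixed cylinder function is close to the limit and, from some index on, to all
  members of the sequence: a late enough term of the sequence in the definition of strong
  convergence. This removes the double limit.\<close>

lemma L2_strong_conv_approx:
  assumes "L2_strong_conv \<nu>n \<nu> fn f" "\<delta> > 0"
  obtains \<phi> where "\<phi> \<in> FCb_infinity" "L2_norm \<nu> (\<lambda>x. \<phi> x - f x) < \<delta>"
    "\<forall>\<^sub>F n in sequentially. L2_norm (\<nu>n n) (\<lambda>x. \<phi> x - fn n x) < \<delta>"
proof -
  obtain \<phi> where \<phi>: "\<And>m. \<phi> m \<in> FCb_infinity" "(\<lambda>m. L2_norm \<nu> (\<lambda>x. \<phi> m x - f x)) \<longlonglongrightarrow> 0"
    "(\<lambda>m. limsup (\<lambda>n. ereal (L2_norm (\<nu>n n) (\<lambda>x. \<phi> m x - fn n x)))) \<longlonglongrightarrow> 0"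
    using assms(1) unfolding L2_strong_conv_def by blast
  have "\<forall>\<^sub>F m in sequentially. L2_norm \<nu> (\<lambda>x. \<phi> m x - f x) < \<delta> \<and>
      limsup (\<lambda>n. ereal (L2_norm (\<nu>n n) (\<lambda>x. \<phi> m x - fn n x))) < ereal \<delta>"
    using \<phi>(2,3) \<open>\<delta> > 0\<close> by (intro eventually_conj order_tendstoD(2)) auto
  then obtain m where m: "L2_norm \<nu> (\<lambda>x. \<phi> m x - f x) < \<delta>"
    "limsup (\<lambda>n. ereal (L2_norm (\<nu>n n) (\<lambda>x. \<phi> m x - fn n x))) < ereal \<delta>"
    using eventually_happens by force
  from Limsup_lessD[OF m(2)] show thesis
    using that[of "\<phi> m"] \<phi>(1) m(1) by simp
qed

locale weak_conv_setting =
  fixes \<nu>n :: "nat \<Rightarrow> 'h::{real_inner, second_countable_topology} measure" and \<nu> :: "'h measure"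
  assumes prob: "prob_space \<nu>" "\<And>n. prob_space (\<nu>n n)"
    and borel: "sets \<nu> = sets borel" "\<And>n. sets (\<nu>n n) = sets borel"
    and weak_conv: "weak_conv_measures \<nu>n \<nu>"
begin

lemma finite_measures: "finite_measure \<nu>" "finite_measure (\<nu>n n)"
  using prob prob_space.finite_measure by auto

lemma continuous_measurable:
  assumes "continuous_on UNIV \<psi>"
  shows "\<psi> \<in> borel_measurable \<nu>" "\<psi> \<in> borel_measurable (\<nu>n n)"
  using borel_measurable_continuous_onI[OF assms] borel measurable_cong_sets by blast+

lemma FCb_L2_space:
  assumes "u \<in> FCb_infinity"
  shows "u \<in> L2_space \<nu>" "u \<in> L2_space (\<nu>n n)"
  using assms by (auto intro!: FCb_infinity_L2_space finite_measures borel)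

lemma integral_tendsto:
  fixes g :: "'h \<Rightarrow> real"
  assumes "continuous_on UNIV g" "bounded (range g)"
  shows "(\<lambda>n. \<integral>x. g x \<partial>\<nu>n n) \<longlonglongrightarrow> (\<integral>x. g x \<partial>\<nu>)"
  using weak_conv assms unfolding weak_conv_measures_def by blast

lemma L2_norm_tendsto:
  assumes "u \<in> FCb_infinity"
  shows "(\<lambda>n. L2_norm (\<nu>n n) u) \<longlonglongrightarrow> L2_norm \<nu> u"
  unfolding L2_norm_def L2_inner_def
  using assms FCb_infinity_continuous FCb_infinity_bounded
  by (intro tendsto_real_sqrt integral_tendsto continuous_on_mult bounded_range_mult)

text \<open>A three-part estimate: both factors are replaced by fixed cylinder functions, under the
  limit measure and under the varying ones. What remains is the integral of a bounded continuous
  function, to which weak convergence applies. The weight 1 gives convergence of inner products and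
  norms; equal sequences give weighted squares.\<close>

lemma L2_strong_conv_integral_tendsto:
  fixes \<psi> :: "'h \<Rightarrow> real"
  assumes fn: "L2_strong_conv \<nu>n \<nu> fn f" and gn: "L2_strong_conv \<nu>n \<nu> gn g"
    and \<psi>: "continuous_on UNIV \<psi>" "bounded (range \<psi>)"
  shows "(\<lambda>n. \<integral>x. \<psi> x * fn n x * gn n x \<partial>\<nu>n n) \<longlonglongrightarrow> (\<integral>x. \<psi> x * f x * g x \<partial>\<nu>)"
proof (rule LIMSEQ_I)
  fix e :: real assume "e > 0"
  obtain M where M: "\<And>x. \<bar>\<psi> x\<bar> \<le> M"
    using \<psi>(2) by (auto simp: bounded_iff)
  have M0: "0 \<le> M"
    using M[of undefined] by simp
  have L2: "\<And>n. fn n \<in> L2_space (\<nu>n n)" "f \<in> L2_space \<nu>" "\<And>n. gn n \<in> L2_space (\<nu>n n)" "g \<in> L2_space \<nu>"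
    using fn gn by (auto simp: L2_strong_conv_def)
  \<comment> \<open>The slack makes the norms of \<phi> and \<eta> strictly less than
    \<open>R\<close> in the limit space, so that they stay below \<open>R\<close> under the varying
    measures from some index on.\<close>
  define R where "R = L2_norm \<nu> f + L2_norm \<nu> g + 3"
  have R: "L2_norm \<nu> f + 3 \<le> R" "L2_norm \<nu> g + 3 \<le> R" "3 \<le> R"
    using L2_norm_nonneg[of \<nu> f] L2_norm_nonneg[of \<nu> g] by (auto simp: R_def)
  \<comment> \<open>Chosen so that the exchange error \<open>M * (3 * R * \<delta>)\<close> is below
    \<open>e / 3\<close>; \<open>M + 1\<close> avoids division by 0 when
    \<open>M = 0\<close>.\<close>
  define \<delta> where "\<delta> = min 1 (e / (9 * R * (M + 1)))"
  have \<delta>: "0 < \<delta>" "\<delta> \<le> 1" "\<delta> \<le> R"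
    using \<open>e > 0\<close> R(3) M0 by (auto simp: \<delta>_def min_le_iff_disj)
  have "M * (3 * R * \<delta>) \<le> M * (3 * R * (e / (9 * R * (M + 1))))"
    using R(3) M0 by (intro mult_left_mono) (auto simp: \<delta>_def)
  also have "\<dots> = (M / (M + 1)) * (e / 3)"
  proof -
    have "R \<noteq> 0" "M + 1 \<noteq> 0"
      using R(3) M0 by auto
    then show ?thesis
      by (simp add: divide_simps)
  qed
  also have "\<dots> < 1 * (e / 3)"
    using M0 \<open>e > 0\<close> by (intro mult_strict_right_mono) auto
  finally have small: "M * (3 * R * \<delta>) < e / 3"
    by simp
  obtain \<phi> where \<phi>: "\<phi> \<in> FCb_infinity" "L2_norm \<nu> (\<lambda>x. \<phi> x - f x) < \<delta>"
    "\<forall>\<^sub>F n in sequentially. L2_norm (\<nu>n n) (\<lambda>x. \<phi> x - fn n x) < \<delta>"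
    using L2_strong_conv_approx[OF fn \<delta>(1)] by blast
  obtain \<eta> where \<eta>: "\<eta> \<in> FCb_infinity" "L2_norm \<nu> (\<lambda>x. \<eta> x - g x) < \<delta>"
    "\<forall>\<^sub>F n in sequentially. L2_norm (\<nu>n n) (\<lambda>x. \<eta> x - gn n x) < \<delta>"
    using L2_strong_conv_approx[OF gn \<delta>(1)] by blast
  have \<phi>R: "L2_norm \<nu> \<phi> < R"
    using L2_norm_triangle[OF L2(2) FCb_L2_space(1)[OF \<phi>(1)]] \<phi>(2) R(1) \<delta>(2)
    by (simp add: L2_norm_minus_commute[of \<nu> f])
  have \<eta>R: "L2_norm \<nu> \<eta> < R"
    using L2_norm_triangle[OF L2(4) FCb_L2_space(1)[OF \<eta>(1)]] \<eta>(2) R(2) \<delta>(2)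
    by (simp add: L2_norm_minus_commute[of \<nu> g])
  have lim: "(\<lambda>n. \<integral>x. \<psi> x * \<phi> x * \<eta> x \<partial>\<nu>n n) \<longlonglongrightarrow> (\<integral>x. \<psi> x * \<phi> x * \<eta> x \<partial>\<nu>)"
    using \<psi> \<phi>(1) \<eta>(1) FCb_infinity_continuous FCb_infinity_bounded
    by (intro integral_tendsto continuous_on_mult bounded_range_mult)
  have lim_e: "\<forall>\<^sub>F n in sequentially.
      dist (\<integral>x. \<psi> x * \<phi> x * \<eta> x \<partial>\<nu>n n) (\<integral>x. \<psi> x * \<phi> x * \<eta> x \<partial>\<nu>) < e / 3"
    using \<open>e > 0\<close> by (intro tendstoD[OF lim]) simp
  have near: "\<bar>(\<integral>x. \<psi> x * f x * g x \<partial>\<nu>) - (\<integral>x. \<psi> x * \<phi> x * \<eta> x \<partial>\<nu>)\<bar> \<le> M * (3 * R * \<delta>)"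
    using \<phi>(2) \<eta>(2) \<phi>R \<eta>R \<delta>(3)
    by (intro integral_mult_diff_bound L2 FCb_L2_space \<phi>(1) \<eta>(1) continuous_measurable \<psi>(1) M) auto
  have "\<forall>\<^sub>F n in sequentially. norm ((\<integral>x. \<psi> x * fn n x * gn n x \<partial>\<nu>n n) - (\<integral>x. \<psi> x * f x * g x \<partial>\<nu>)) < e"
    using \<phi>(3) \<eta>(3) order_tendstoD(2)[OF L2_norm_tendsto[OF \<phi>(1)] \<phi>R]
      order_tendstoD(2)[OF L2_norm_tendsto[OF \<eta>(1)] \<eta>R]
      lim_e
  proof eventually_elim
    case (elim n)
    have "\<bar>(\<integral>x. \<psi> x * fn n x * gn n x \<partial>\<nu>n n) - (\<integral>x. \<psi> x * \<phi> x * \<eta> x \<partial>\<nu>n n)\<bar> \<le> M * (3 * R * \<delta>)"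
      using elim \<delta>(3)
      by (intro integral_mult_diff_bound L2 FCb_L2_space \<phi>(1) \<eta>(1) continuous_measurable \<psi>(1) M) auto
    then show ?case
      using near elim(5) small unfolding dist_real_def real_norm_def by linarith
  qed
  then show "\<exists>N. \<forall>n\<ge>N. norm ((\<integral>x. \<psi> x * fn n x * gn n x \<partial>\<nu>n n) - (\<integral>x. \<psi> x * f x * g x \<partial>\<nu>)) < e"
    by (simp add: eventually_sequentially)
qed

lemma L2_strong_imp_weak_conv:
  assumes "L2_strong_conv \<nu>n \<nu> fn f"
  shows "L2_weak_conv \<nu>n \<nu> fn f"
proof -
  have "(\<lambda>n. L2_inner (\<nu>n n) (fn n) (gn n)) \<longlonglongrightarrow> L2_inner \<nu> f g"
    if "L2_strong_conv \<nu>n \<nu> gn g" for gn g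
    using L2_strong_conv_integral_tendsto[OF assms that, of "\<lambda>_. 1"] by (simp add: L2_inner_def)
  then show ?thesis
    using assms by (auto simp: L2_weak_conv_def L2_strong_conv_def)
qed

text \<open>Energies are infinite off the domains, so a finite limit forces membership from some
  index on. Convergence of the energies, not just an upper bound, matters because the constant of
  the inequality is an arbitrary real: if it is negative, an upper bound on the energies bounds the
  right-hand side from the wrong side.\<close>

lemma Mosco_recovery:
  assumes "Mosco_conv Q Dn \<nu>n D \<nu>" and f: "f \<in> form_dom Q D \<nu>"
  obtains fn where "L2_strong_conv \<nu>n \<nu> fn f"
    "\<forall>\<^sub>F n in sequentially. fn n \<in> form_dom Q (Dn n) (\<nu>n n)"
    "(\<lambda>n. form Q (Dn n) (\<nu>n n) (fn n) (fn n)) \<longlonglongrightarrow> form Q D \<nu> f f"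
proof -
  let ?E = "\<lambda>fn n. form_energy Q (Dn n) (\<nu>n n) (fn n)"
  obtain fn where fn: "L2_strong_conv \<nu>n \<nu> fn f" "limsup (?E fn) \<le> form_energy Q D \<nu> f"
    using assms unfolding Mosco_conv_def by blast
  have "form_energy Q D \<nu> f \<le> liminf (?E fn)"
    using assms(1) L2_strong_imp_weak_conv[OF fn(1)] unfolding Mosco_conv_def by blast
  moreover have "liminf (?E fn) \<le> limsup (?E fn)"
    by (rule Liminf_le_Limsup) simp
  ultimately have "?E fn \<longlonglongrightarrow> form_energy Q D \<nu> f"
    using fn(2) by (intro Liminf_eq_Limsup) auto
  then have lim: "?E fn \<longlonglongrightarrow> ereal (form Q D \<nu> f f)"
    using f by (simp add: form_energy_def)
  then have "\<forall>\<^sub>F n in sequentially. ?E fn n < \<infinity>"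
    by (rule order_tendstoD(2)) simp
  then have dom: "\<forall>\<^sub>F n in sequentially. fn n \<in> form_dom Q (Dn n) (\<nu>n n)"
    by eventually_elim (auto simp: form_energy_def split: if_splits)
  then have "\<forall>\<^sub>F n in sequentially. ?E fn n = ereal (form Q (Dn n) (\<nu>n n) (fn n) (fn n))"
    by eventually_elim (simp add: form_energy_def)
  with lim have "(\<lambda>n. ereal (form Q (Dn n) (\<nu>n n) (fn n) (fn n))) \<longlonglongrightarrow> ereal (form Q D \<nu> f f)"
    by (rule Lim_transform_eventually)
  then show thesis
    using that fn(1) dom by simp
qed

end

section \<open>Relative entropy and its dual formula\<close>

text \<open>The square of \<open>f\<close> is a version of the Radon-Nikodym derivative, so the
  value infinity means exactly that f^2 ln f^2 is not integrable. Where f vanishes, the factor f^2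
  makes the value assigned to ln 0 irrelevant.\<close>

lemma rel_entropy_density:
  assumes "prob_space \<nu>" and [measurable]: "f \<in> borel_measurable \<nu>"
  shows "rel_entropy (density \<nu> (\<lambda>x. ennreal ((f x)\<^sup>2))) \<nu> =
    (if integrable \<nu> (\<lambda>x. (f x)\<^sup>2 * ln ((f x)\<^sup>2))
     then ereal (\<integral>x. (f x)\<^sup>2 * ln ((f x)\<^sup>2) \<partial>\<nu>) else \<infinity>)"
proof -
  interpret prob_space \<nu> by fact
  let ?\<mu> = "density \<nu> (\<lambda>x. ennreal ((f x)\<^sup>2))"
  have log: "log (exp 1) = (ln :: real \<Rightarrow> real)"
    by (simp add: log_def fun_eq_iff)
  have "AE x in \<nu>. ennreal ((f x)\<^sup>2) = RN_deriv \<nu> ?\<mu> x"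
    by (rule RN_deriv_unique) simp_all
  then have ae: "AE x in \<nu>. (f x)\<^sup>2 * entropy_density (exp 1) \<nu> ?\<mu> x = (f x)\<^sup>2 * ln ((f x)\<^sup>2)"
  proof eventually_elim
    case (elim x)
    from elim[symmetric] show ?case
      by (simp add: entropy_density_def log)
  qed
  have "integrable ?\<mu> (entropy_density (exp 1) \<nu> ?\<mu>) \<longleftrightarrow>
      integrable \<nu> (\<lambda>x. (f x)\<^sup>2 * entropy_density (exp 1) \<nu> ?\<mu> x)"
    by (rule integrable_real_density) (auto simp: entropy_density_def)
  also have "\<dots> \<longleftrightarrow> integrable \<nu> (\<lambda>x. (f x)\<^sup>2 * ln ((f x)\<^sup>2))"
    using ae by (intro integrable_cong_AE) (auto simp: entropy_density_def)
  finally have "integrable ?\<mu> (entropy_density (exp 1) \<nu> ?\<mu>) \<longleftrightarrow>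
      integrable \<nu> (\<lambda>x. (f x)\<^sup>2 * ln ((f x)\<^sup>2))" .
  moreover have "KL_divergence (exp 1) \<nu> ?\<mu> = (\<integral>x. (f x)\<^sup>2 * ln ((f x)\<^sup>2) \<partial>\<nu>)"
    by (subst KL_density) (auto simp: log)
  moreover have "absolutely_continuous \<nu> ?\<mu>"
    by (rule absolutely_continuousI_density) simp
  ultimately show ?thesis
    by (simp add: rel_entropy_def)
qed

text \<open>Young's inequality for s ln s and its convex conjugate e^(t-1), obtained from 1 + a
  \<le> e^a at a = t - 1 - ln s. Equality holds at t = 1 + ln s for s > 0, which is why the dual
  form loses nothing.\<close>

lemma mult_le_mult_ln_plus_exp:
  fixes s t :: real
  assumes "0 \<le> s"
  shows "s * t \<le> s * ln s + exp (t - 1)"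
proof (cases "s = 0")
  case False
  then have s: "s > 0"
    using assms by simp
  have "s * (1 + (t - 1 - ln s)) \<le> s * exp (t - 1 - ln s)"
    using s by (intro mult_left_mono exp_ge_add_one_self) auto
  also have "\<dots> = exp (t - 1)"
    using s by (simp add: exp_diff)
  finally show ?thesis
    by (simp add: algebra_simps)
qed simp

text \<open>A finite \<open>K\<close> excludes the infinite branch of the entropy, so Young's
  inequality can be integrated pointwise.\<close>

lemma integral_le_rel_entropy:
  assumes "prob_space \<nu>" and f: "f \<in> L2_space \<nu>"
    and ent: "rel_entropy (density \<nu> (\<lambda>x. ennreal ((f x)\<^sup>2))) \<nu> \<le> ereal K"
    and \<psi>[measurable]: "\<psi> \<in> borel_measurable \<nu>" and M: "\<And>x. \<bar>\<psi> x\<bar> \<le> M"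
  shows "(\<integral>x. \<psi> x * (f x)\<^sup>2 \<partial>\<nu>) \<le> K + (\<integral>x. exp (\<psi> x - 1) \<partial>\<nu>)"
proof -
  interpret prob_space \<nu> by fact
  have [measurable]: "f \<in> borel_measurable \<nu>" and f2: "integrable \<nu> (\<lambda>x. (f x)\<^sup>2)"
    using f by (auto simp: L2_space_def)
  have int: "integrable \<nu> (\<lambda>x. (f x)\<^sup>2 * ln ((f x)\<^sup>2))" and K: "(\<integral>x. (f x)\<^sup>2 * ln ((f x)\<^sup>2) \<partial>\<nu>) \<le> K"
    using ent by (auto simp: rel_entropy_density[OF assms(1)] split: if_splits)
  have exp_le: "exp (\<psi> x - 1) \<le> exp (M - 1)" for x
    using M[of x] by simp
  have int_exp: "integrable \<nu> (\<lambda>x. exp (\<psi> x - 1))"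
    using exp_le by (intro integrable_const_bound[of _ "exp (M - 1)"]) auto
  have "(\<integral>x. \<psi> x * (f x)\<^sup>2 \<partial>\<nu>) \<le> (\<integral>x. (f x)\<^sup>2 * ln ((f x)\<^sup>2) + exp (\<psi> x - 1) \<partial>\<nu>)"
  proof (rule integral_mono)
    have M0: "0 \<le> M"
      using M[of undefined] by simp
    show "integrable \<nu> (\<lambda>x. \<psi> x * (f x)\<^sup>2)"
      using M M0 by (intro Bochner_Integration.integrable_bound[OF integrable_mult_right[OF f2, of M]])
        (auto simp: abs_mult intro!: mult_right_mono)
    show "\<psi> x * (f x)\<^sup>2 \<le> (f x)\<^sup>2 * ln ((f x)\<^sup>2) + exp (\<psi> x - 1)" for x
      using mult_le_mult_ln_plus_exp[of "(f x)\<^sup>2" "\<psi> x"] by (simp add: mult.commute)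
  qed (use int int_exp in simp)
  also have "\<dots> \<le> K + (\<integral>x. exp (\<psi> x - 1) \<partial>\<nu>)"
    using int int_exp K by simp
  finally show ?thesis .
qed

text \<open>The test functions depend on the approximants through a logarithm, so norm convergence
  is turned into pointwise convergence for use with dominated convergence.\<close>

lemma L2_tendsto_AE_subseq:
  assumes \<phi>: "\<And>m. \<phi> m \<in> L2_space \<nu>" and f: "f \<in> L2_space \<nu>"
    and lim: "(\<lambda>m. L2_norm \<nu> (\<lambda>x. \<phi> m x - f x)) \<longlonglongrightarrow> 0"
  obtains r :: "nat \<Rightarrow> nat" where "strict_mono r" "AE x in \<nu>. (\<lambda>m. \<phi> (r m) x) \<longlonglongrightarrow> f x"
proof -
  have int: "integrable \<nu> (\<lambda>x. (\<phi> m x - f x)\<^sup>2)" for m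
    using L2.diff_mem[OF \<phi> f, of m] by (simp add: L2_space_def)
  have eq: "(L2_norm \<nu> g)\<^sup>2 = (\<integral>x. norm ((g x)\<^sup>2) \<partial>\<nu>)" for g
    using L2_norm_def[of \<nu> g] by (simp add: L2_inner_def power2_eq_square)
  have "(\<lambda>m. \<integral>x. norm ((\<phi> m x - f x)\<^sup>2) \<partial>\<nu>) \<longlonglongrightarrow> 0"
    using tendsto_power[OF lim, of 2] unfolding eq by simp
  from tendsto_L1_AE_subseq[OF int this]
  obtain r :: "nat \<Rightarrow> nat" where r: "strict_mono r"
    "AE x in \<nu>. (\<lambda>m. (\<phi> (r m) x - f x)\<^sup>2) \<longlonglongrightarrow> 0"
    by blast
  from r(2) have "AE x in \<nu>. (\<lambda>m. \<phi> (r m) x) \<longlonglongrightarrow> f x"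
  proof eventually_elim
    case (elim x)
    from tendsto_real_sqrt[OF elim] have "(\<lambda>m. \<phi> (r m) x - f x) \<longlonglongrightarrow> 0"
      by (simp add: tendsto_rabs_zero_iff)
    then show ?case
      by (simp add: LIM_zero_iff)
  qed
  with r(1) show thesis
    by (rule that)
qed

text \<open>The bound -1 is Young's inequality at t = 1, which reads s ln s \<ge> s - 1. It is
  needed only for s \<le> 1, where \<open>M \<ge> 1\<close> makes the clip inactive; for s > 1 the
  product is nonnegative.\<close>

lemma mult_ln_min_bounds:
  fixes s M :: real
  assumes "0 \<le> s" "1 \<le> M"
  shows "- 1 \<le> s * ln (min s M)" "s * ln (min s M) \<le> s * ln M"
proof -
  have le: "ln (min s M) \<le> ln M" if "s > 0"
    using that assms by (intro ln_mono) auto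
  then show "s * ln (min s M) \<le> s * ln M"
    using assms by (cases "s = 0") (auto intro!: mult_left_mono)
  show "- 1 \<le> s * ln (min s M)"
  proof (cases "s \<le> 1")
    case True
    then show ?thesis
      using mult_le_mult_ln_plus_exp[OF assms(1), of 1] assms by (simp add: min_def)
  next
    case False
    then have "0 \<le> s * ln (min s M)"
      using assms by (intro mult_nonneg_nonneg) (auto simp: ln_ge_zero_iff)
    then show ?thesis
      by simp
  qed
qed

section \<open>From the dual inequalities back to the entropy on the limit space\<close>

context
  fixes \<nu> :: "'h::{real_inner, second_countable_topology} measure" and f :: "'h \<Rightarrow> real" and K :: real
    and \<phi> :: "nat \<Rightarrow> 'h \<Rightarrow> real"
  assumes prob: "prob_space \<nu>" and borel: "sets \<nu> = sets borel"
    and f: "f \<in> L2_space \<nu>" "(\<integral>x. (f x)\<^sup>2 \<partial>\<nu>) = 1"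
    and \<phi>: "\<And>m. continuous_on UNIV (\<phi> m)" "\<And>m. bounded (range (\<phi> m))"
      "(\<lambda>m. L2_norm \<nu> (\<lambda>x. \<phi> m x - f x)) \<longlonglongrightarrow> 0"
    and dual: "\<And>\<psi> :: 'h \<Rightarrow> real. continuous_on UNIV \<psi> \<Longrightarrow> bounded (range \<psi>) \<Longrightarrow>
      (\<integral>x. \<psi> x * (f x)\<^sup>2 \<partial>\<nu>) \<le> K + (\<integral>x. exp (\<psi> x - 1) \<partial>\<nu>)"
begin

interpretation prob_space \<nu>
  by (rule prob)

lemma f_meas [measurable]: "f \<in> borel_measurable \<nu>"
  and f_int: "integrable \<nu> (\<lambda>x. (f x)\<^sup>2)"
  using f by (auto simp: L2_space_def)

text \<open>The optimal test function in \<open>dual\<close> is \<open>1 + ln (f\<^sup>2)\<close>; it is reached through the bounded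
  continuous functions \<open>1 + ln (max \<epsilon> (min (\<phi>\<^sub>m\<^sup>2) M))\<close>.\<close>

lemma integral_mult_ln_clip_le:
  assumes "0 < \<epsilon>" "\<epsilon> \<le> 1" "1 \<le> M"
  shows "integrable \<nu> (\<lambda>x. (f x)\<^sup>2 * ln (max \<epsilon> (min ((f x)\<^sup>2) M)))" (is ?int)
    and "(\<integral>x. (f x)\<^sup>2 * ln (max \<epsilon> (min ((f x)\<^sup>2) M)) \<partial>\<nu>) \<le> K + \<epsilon>" (is ?le)
proof -
  \<comment> \<open>The lower cut bounds the logarithm where the square is near 0, the upper cut
    where it is large; \<open>c\<close> is continuous, so composing it with the continuous
    approximants keeps the test functions admissible.\<close>
  define c where "c s = max \<epsilon> (min s M)" for s :: real
  define B where "B = \<bar>ln \<epsilon>\<bar> + \<bar>ln M\<bar>"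
  have c: "\<epsilon> \<le> c s" "c s \<le> M" "0 < c s" for s
    using assms by (auto simp: c_def)
  have ln_c: "\<bar>ln (c s)\<bar> \<le> B" for s
  proof -
    have "ln \<epsilon> \<le> ln (c s)" "ln (c s) \<le> ln M"
      using c[of s] assms by (auto intro!: ln_mono)
    then show ?thesis
      by (auto simp: B_def)
  qed
  have c_le: "c s \<le> s + \<epsilon>" if "0 \<le> s" for s
    using that assms by (auto simp: c_def)
  have c_cont: "continuous_on UNIV c"
    unfolding c_def by (intro continuous_intros)
  have c_meas [measurable]: "c \<in> borel_measurable borel"
    unfolding c_def by measurable
  have B0: "0 \<le> B"
    by (simp add: B_def)
  show int: ?int
    unfolding c_def[symmetric]
    using ln_c B0
    by (intro Bochner_Integration.integrable_bound[OF integrable_mult_left[OF f_int, of B]])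
      (auto simp: abs_mult intro!: mult_left_mono)
  have \<phi>_L2: "\<phi> m \<in> L2_space \<nu>" for m
    using finite_measure_axioms borel \<phi>(1,2) by (rule bounded_continuous_L2_space)
  then have [measurable]: "\<phi> m \<in> borel_measurable \<nu>" for m
    by (simp add: L2_space_def)
  obtain r :: "nat \<Rightarrow> nat" where r: "AE x in \<nu>. (\<lambda>m. \<phi> (r m) x) \<longlonglongrightarrow> f x"
    using L2_tendsto_AE_subseq[OF \<phi>_L2 f(1) \<phi>(3)] by blast
  from r have c_lim: "AE x in \<nu>. (\<lambda>m. c ((\<phi> (r m) x)\<^sup>2)) \<longlonglongrightarrow> c ((f x)\<^sup>2)"
  proof eventually_elim
    case (elim x)
    show ?case
      by (rule continuous_on_tendsto_compose[OF c_cont tendsto_power[OF elim]]) auto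
  qed
  \<comment> \<open>For the test function 1 + ln c the conjugate term e^(\<psi>-1) is c
    itself.\<close>
  have dual_m: "(\<integral>x. (1 + ln (c ((\<phi> m x)\<^sup>2))) * (f x)\<^sup>2 \<partial>\<nu>) \<le> K + (\<integral>x. c ((\<phi> m x)\<^sup>2) \<partial>\<nu>)" for m
  proof -
    have "continuous_on UNIV (\<lambda>x. c ((\<phi> m x)\<^sup>2))"
      by (intro continuous_on_compose2[OF c_cont] continuous_intros \<phi>(1)) auto
    then have cont: "continuous_on UNIV (\<lambda>x. 1 + ln (c ((\<phi> m x)\<^sup>2)))"
      using c(3) by (intro continuous_intros) (auto simp: less_imp_neq[symmetric])
    have "\<bar>1 + ln (c ((\<phi> m x)\<^sup>2))\<bar> \<le> 1 + B" for x
      using ln_c[of "(\<phi> m x)\<^sup>2"] by linarith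
    then have "bounded (range (\<lambda>x. 1 + ln (c ((\<phi> m x)\<^sup>2))))"
      by (auto simp: bounded_iff)
    from dual[OF cont this] show ?thesis
      using c(3) by simp
  qed
  have lim1: "(\<lambda>m. \<integral>x. (1 + ln (c ((\<phi> (r m) x)\<^sup>2))) * (f x)\<^sup>2 \<partial>\<nu>) \<longlonglongrightarrow>
      (\<integral>x. (1 + ln (c ((f x)\<^sup>2))) * (f x)\<^sup>2 \<partial>\<nu>)"
  proof (rule integral_dominated_convergence[where w = "\<lambda>x. (1 + B) * (f x)\<^sup>2"])
    show "integrable \<nu> (\<lambda>x. (1 + B) * (f x)\<^sup>2)"
      using f_int by simp
    show "AE x in \<nu>. (\<lambda>m. (1 + ln (c ((\<phi> (r m) x)\<^sup>2))) * (f x)\<^sup>2) \<longlonglongrightarrow> (1 + ln (c ((f x)\<^sup>2))) * (f x)\<^sup>2"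
      using c_lim
    proof eventually_elim
      case (elim x)
      show ?case
        using c(3)[of "(f x)\<^sup>2"] by (intro tendsto_intros elim) auto
    qed
    have "\<bar>1 + ln (c s)\<bar> \<le> 1 + B" for s
      using ln_c[of s] by linarith
    then show "AE x in \<nu>. norm ((1 + ln (c ((\<phi> (r m) x)\<^sup>2))) * (f x)\<^sup>2) \<le> (1 + B) * (f x)\<^sup>2" for m
      by (auto simp: abs_mult intro!: mult_right_mono)
  qed measurable
  have lim2: "(\<lambda>m. \<integral>x. c ((\<phi> (r m) x)\<^sup>2) \<partial>\<nu>) \<longlonglongrightarrow> (\<integral>x. c ((f x)\<^sup>2) \<partial>\<nu>)"
    using c_lim c
    by (intro integral_dominated_convergence[where w = "\<lambda>x. M"]) (auto simp: abs_of_pos)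
  \<comment> \<open>As f^2 has mass 1, the summand 1 of the test function contributes 1 on the left,
    while \<open>c_le\<close> turns the right-hand integral into at most 1 + \<epsilon>. The two
    ones cancel and leave the error \<epsilon>.\<close>
  have "(\<integral>x. (1 + ln (c ((f x)\<^sup>2))) * (f x)\<^sup>2 \<partial>\<nu>) \<le> K + (\<integral>x. c ((f x)\<^sup>2) \<partial>\<nu>)"
    using lim1 tendsto_add[OF tendsto_const lim2] by (rule LIMSEQ_le) (use dual_m in auto)
  also have "(\<integral>x. c ((f x)\<^sup>2) \<partial>\<nu>) \<le> (\<integral>x. (f x)\<^sup>2 + \<epsilon> \<partial>\<nu>)"
  proof (rule integral_mono)
    show "integrable \<nu> (\<lambda>x. c ((f x)\<^sup>2))"
      using c by (intro integrable_const_bound[of _ M]) (auto simp: abs_of_pos)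
  qed (use f_int c_le in auto)
  also have "(\<integral>x. (f x)\<^sup>2 + \<epsilon> \<partial>\<nu>) = 1 + \<epsilon>"
    using f_int f(2) by (simp add: prob_space)
  also have "(\<integral>x. (1 + ln (c ((f x)\<^sup>2))) * (f x)\<^sup>2 \<partial>\<nu>) =
      (\<integral>x. (f x)\<^sup>2 + (f x)\<^sup>2 * ln (c ((f x)\<^sup>2)) \<partial>\<nu>)"
    by (intro Bochner_Integration.integral_cong) (auto simp: algebra_simps)
  also have "\<dots> = 1 + (\<integral>x. (f x)\<^sup>2 * ln (c ((f x)\<^sup>2)) \<partial>\<nu>)"
    using f_int f(2) int by (simp add: c_def)
  finally show ?le
    by (simp add: c_def)
qed

text \<open>Dropping the lower clip can only decrease the logarithm where f is nonzero, and
  elsewhere the factor f^2 vanishes. The bound K + \<epsilon> thus passes to an integral that no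
  longer depends on \<epsilon>.\<close>

lemma integral_mult_ln_min_le:
  assumes "1 \<le> M"
  shows "integrable \<nu> (\<lambda>x. (f x)\<^sup>2 * ln (min ((f x)\<^sup>2) M))" (is ?int)
    and "(\<integral>x. (f x)\<^sup>2 * ln (min ((f x)\<^sup>2) M) \<partial>\<nu>) \<le> K" (is ?le)
proof -
  have bound: "\<bar>(f x)\<^sup>2 * ln (min ((f x)\<^sup>2) M)\<bar> \<le> \<bar>(f x)\<^sup>2 * ln M + 1\<bar>" for x
  proof -
    have "0 \<le> (f x)\<^sup>2 * ln M"
      using assms by simp
    then show ?thesis
      using mult_ln_min_bounds[OF zero_le_power2 assms, of "f x"] by linarith
  qed
  show int: ?int
  proof (rule Bochner_Integration.integrable_bound)
    show "integrable \<nu> (\<lambda>x. (f x)\<^sup>2 * ln M + 1)"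
      using f_int by simp
    show "AE x in \<nu>. norm ((f x)\<^sup>2 * ln (min ((f x)\<^sup>2) M)) \<le> norm ((f x)\<^sup>2 * ln M + 1)"
      using bound by simp
  qed measurable
  show ?le
  proof (rule field_le_epsilon)
    fix e :: real assume "e > 0"
    define \<epsilon> where "\<epsilon> = min e 1"
    have \<epsilon>: "0 < \<epsilon>" "\<epsilon> \<le> 1" "\<epsilon> \<le> e"
      using \<open>e > 0\<close> by (auto simp: \<epsilon>_def)
    have "(f x)\<^sup>2 * ln (min ((f x)\<^sup>2) M) \<le> (f x)\<^sup>2 * ln (max \<epsilon> (min ((f x)\<^sup>2) M))" for x
    proof (cases "f x = 0")
      case False
      then show ?thesis
        using assms by (intro mult_left_mono ln_mono) auto
    qed simp
    then have "(\<integral>x. (f x)\<^sup>2 * ln (min ((f x)\<^sup>2) M) \<partial>\<nu>) \<le>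
        (\<integral>x. (f x)\<^sup>2 * ln (max \<epsilon> (min ((f x)\<^sup>2) M)) \<partial>\<nu>)"
      using int integral_mult_ln_clip_le(1)[OF \<epsilon>(1,2) assms] by (intro integral_mono)
    also have "\<dots> \<le> K + e"
      using integral_mult_ln_clip_le(2)[OF \<epsilon>(1,2) assms] \<epsilon>(3) by simp
    finally show "(\<integral>x. (f x)\<^sup>2 * ln (min ((f x)\<^sup>2) M) \<partial>\<nu>) \<le> K + e" .
  qed
qed

text \<open>Monotone convergence as the upper clip grows: the uniformly bounded integrals give the
  integrability of f^2 ln f^2, hence a finite entropy, together with its bound.\<close>

lemma rel_entropy_le_of_dual:
  "rel_entropy (density \<nu> (\<lambda>x. ennreal ((f x)\<^sup>2))) \<nu> \<le> ereal K"
proof -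
  \<comment> \<open>\<open>Suc n\<close> keeps the clip at least 1, as the lower bound -1 requires.
    The summand 1 then makes \<open>v\<close> nonnegative and costs exactly 1 under a probability
    measure.\<close>
  define v where "v n x = (f x)\<^sup>2 * ln (min ((f x)\<^sup>2) (real (Suc n))) + 1" for n x
  have M: "1 \<le> real (Suc n)" for n
    by simp
  have v_int: "integrable \<nu> (v n)" for n
    unfolding v_def using integral_mult_ln_min_le(1)[OF M] by simp
  have v_mono: "v m x \<le> v n x" if "m \<le> n" for m n x
  proof (cases "f x = 0")
    case False
    then show ?thesis
      using that unfolding v_def by (intro add_right_mono mult_left_mono ln_mono) auto
  qed (simp add: v_def)
  have v_le: "(\<integral>x. v n x \<partial>\<nu>) \<le> K + 1" for n
    unfolding v_def using integral_mult_ln_min_le[OF M, of n] by (simp add: prob_space)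
  have v_lim: "(\<lambda>n. v n x) \<longlonglongrightarrow> (f x)\<^sup>2 * ln ((f x)\<^sup>2) + 1" for x
  proof (rule tendsto_eventually)
    obtain N where N: "(f x)\<^sup>2 \<le> real N"
      using real_arch_simple by blast
    show "\<forall>\<^sub>F n in sequentially. v n x = (f x)\<^sup>2 * ln ((f x)\<^sup>2) + 1"
      using eventually_ge_at_top[of N]
    proof eventually_elim
      case (elim n)
      then have "min ((f x)\<^sup>2) (real (Suc n)) = (f x)\<^sup>2"
        using N by (intro min_absorb1) linarith
      then show ?case
        by (simp add: v_def)
    qed
  qed
  have "incseq (\<lambda>n. \<integral>x. v n x \<partial>\<nu>)"
    using v_int v_mono by (intro monoI integral_mono) auto
  then obtain L where L: "(\<lambda>n. \<integral>x. v n x \<partial>\<nu>) \<longlonglongrightarrow> L"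
    using incseq_convergent[of "\<lambda>n. \<integral>x. v n x \<partial>\<nu>" "K + 1"] v_le by blast
  have "L \<le> K + 1"
    using L v_le by (intro LIMSEQ_le_const2) auto
  have "0 \<le> v n x" for n x
    using mult_ln_min_bounds(1)[of "(f x)\<^sup>2", OF _ M, of n] by (simp add: v_def)
  then have pos: "AE x in \<nu>. 0 \<le> v n x" for n
    by simp
  have mono: "AE x in \<nu>. mono (\<lambda>n. v n x)"
    using v_mono by (simp add: mono_def)
  have lim: "AE x in \<nu>. (\<lambda>n. v n x) \<longlonglongrightarrow> (f x)\<^sup>2 * ln ((f x)\<^sup>2) + 1"
    using v_lim by simp
  have meas: "(\<lambda>x. (f x)\<^sup>2 * ln ((f x)\<^sup>2) + 1) \<in> borel_measurable \<nu>"
    by measurable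
  have int1: "integrable \<nu> (\<lambda>x. (f x)\<^sup>2 * ln ((f x)\<^sup>2) + 1)"
    by (rule integral_monotone_convergence_nonneg(1)[OF v_int mono pos lim L meas])
  then have "integrable \<nu> (\<lambda>x. ((f x)\<^sup>2 * ln ((f x)\<^sup>2) + 1) - 1)"
    by (intro Bochner_Integration.integrable_diff) auto
  then have int: "integrable \<nu> (\<lambda>x. (f x)\<^sup>2 * ln ((f x)\<^sup>2))"
    by simp
  have "(\<integral>x. (f x)\<^sup>2 * ln ((f x)\<^sup>2) + 1 \<partial>\<nu>) = L"
    by (rule integral_monotone_convergence_nonneg(2)[OF v_int mono pos lim L meas])
  then have "(\<integral>x. (f x)\<^sup>2 * ln ((f x)\<^sup>2) \<partial>\<nu>) \<le> K"
    using int \<open>L \<le> K + 1\<close> by (simp add: prob_space)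
  then show ?thesis
    using int by (simp add: rel_entropy_density[OF prob f_meas])
qed

end

theorem proposition6p2:
  fixes Q :: "'h::{real_inner, polish_space} \<Rightarrow>\<^sub>L 'h"
    and D :: "'h \<Rightarrow> 'h \<Rightarrow>\<^sub>L 'h" and Dn :: "nat \<Rightarrow> 'h \<Rightarrow> 'h \<Rightarrow>\<^sub>L 'h"
    and \<nu> :: "'h measure" and \<nu>n :: "nat \<Rightarrow> 'h measure"
    and C :: real
  assumes "positive_trace_class Q"
    and "\<And>x. positive_op (D x)" and "\<And>n x. positive_op (Dn n x)"
    and "prob_space \<nu>" and "sets \<nu> = sets borel"
    and "\<And>n. prob_space (\<nu>n n)" and "\<And>n. sets (\<nu>n n) = sets borel"
    and "closable_form Q D \<nu>" and "\<And>n. closable_form Q (Dn n) (\<nu>n n)"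
    and "Mosco_conv Q Dn \<nu>n D \<nu>"
    and "weak_conv_measures \<nu>n \<nu>"
    and "\<And>n f. f \<in> form_dom Q (Dn n) (\<nu>n n) \<Longrightarrow> (\<integral>x. (f x)\<^sup>2 \<partial>\<nu>n n) = 1 \<Longrightarrow>
           rel_entropy (density (\<nu>n n) (\<lambda>x. ennreal ((f x)\<^sup>2))) (\<nu>n n)
             \<le> ereal (2 * C * form Q (Dn n) (\<nu>n n) f f)"
  shows "\<forall>f\<in>form_dom Q D \<nu>. (\<integral>x. (f x)\<^sup>2 \<partial>\<nu>) = 1 \<longrightarrow>
           rel_entropy (density \<nu> (\<lambda>x. ennreal ((f x)\<^sup>2))) \<nu> \<le> ereal (2 * C * form Q D \<nu> f f)"
proof (intro ballI impI)
  fix f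
  assume dom: "f \<in> form_dom Q D \<nu>" and norm: "(\<integral>x. (f x)\<^sup>2 \<partial>\<nu>) = 1"
  interpret weak_conv_setting \<nu>n \<nu>
    by (intro weak_conv_setting.intro assms)
  let ?F = "\<lambda>n g. form Q (Dn n) (\<nu>n n) g g"
  obtain fn where fn: "L2_strong_conv \<nu>n \<nu> fn f"
    and fn_dom: "\<forall>\<^sub>F n in sequentially. fn n \<in> form_dom Q (Dn n) (\<nu>n n)"
    and energy: "(\<lambda>n. ?F n (fn n)) \<longlonglongrightarrow> form Q D \<nu> f f"
    using Mosco_recovery[OF assms(10) dom] by blast
  have L2: "fn n \<in> L2_space (\<nu>n n)" "f \<in> L2_space \<nu>" for n
    using fn by (auto simp: L2_strong_conv_def)
  define R where "R n = (\<integral>x. (fn n x)\<^sup>2 \<partial>\<nu>n n)" for n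
  have R: "R \<longlonglongrightarrow> 1"
    using L2_strong_conv_integral_tendsto[OF fn fn, of "\<lambda>_. 1"] norm
    by (simp add: R_def[abs_def] power2_eq_square)
  have dual: "(\<integral>x. \<psi> x * (f x)\<^sup>2 \<partial>\<nu>) \<le> 2 * C * form Q D \<nu> f f + (\<integral>x. exp (\<psi> x - 1) \<partial>\<nu>)"
    if \<psi>: "continuous_on UNIV \<psi>" "bounded (range \<psi>)" for \<psi> :: "'h \<Rightarrow> real"
  proof -
    obtain M where M: "\<And>x. \<bar>\<psi> x\<bar> \<le> M"
      using \<psi>(2) by (auto simp: bounded_iff)
    have exp_cont: "continuous_on UNIV (\<lambda>x. exp (\<psi> x - 1))"
      by (intro continuous_intros \<psi>(1))
    have "\<bar>exp (\<psi> x - 1)\<bar> \<le> exp (M - 1)" for x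
      using M[of x] by simp
    then have exp_bdd: "bounded (range (\<lambda>x. exp (\<psi> x - 1)))"
      by (intro boundedI[of _ "exp (M - 1)"]) auto
    have "(\<lambda>n. (\<integral>x. \<psi> x * fn n x * fn n x \<partial>\<nu>n n) / R n) \<longlonglongrightarrow> (\<integral>x. \<psi> x * f x * f x \<partial>\<nu>) / 1"
      using L2_strong_conv_integral_tendsto[OF fn fn \<psi>] R by (rule tendsto_divide) simp
    then have lhs: "(\<lambda>n. (\<integral>x. \<psi> x * (fn n x)\<^sup>2 \<partial>\<nu>n n) / R n) \<longlonglongrightarrow> (\<integral>x. \<psi> x * (f x)\<^sup>2 \<partial>\<nu>)"
      by (simp add: power2_eq_square mult.assoc)
    have "(\<lambda>n. 2 * C * (?F n (fn n) / R n) + (\<integral>x. exp (\<psi> x - 1) \<partial>\<nu>n n)) \<longlonglongrightarrow>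
        2 * C * (form Q D \<nu> f f / 1) + (\<integral>x. exp (\<psi> x - 1) \<partial>\<nu>)"
      by (intro tendsto_intros energy R integral_tendsto exp_cont exp_bdd) simp
    then have rhs: "(\<lambda>n. 2 * C * (?F n (fn n) / R n) + (\<integral>x. exp (\<psi> x - 1) \<partial>\<nu>n n)) \<longlonglongrightarrow>
        2 * C * form Q D \<nu> f f + (\<integral>x. exp (\<psi> x - 1) \<partial>\<nu>)"
      by simp
    \<comment> \<open>The log-Sobolev hypothesis speaks only of functions of mass 1 in the domain.
      From some index on, \<open>fn n\<close> lies in the domain and its mass \<open>R n\<close>,
      which tends to 1, is positive, so it can be normalised.\<close>
    have "\<forall>\<^sub>F n in sequentially. (\<integral>x. \<psi> x * (fn n x)\<^sup>2 \<partial>\<nu>n n) / R n \<le>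
        2 * C * (?F n (fn n) / R n) + (\<integral>x. exp (\<psi> x - 1) \<partial>\<nu>n n)"
      using fn_dom order_tendstoD(1)[OF R zero_less_one]
    proof eventually_elim
      case (elim n)
      \<comment> \<open>Both the weighted square integral and the energy scale by
        \<open>c\<^sup>2\<close>, which equals \<open>1 / R n\<close>; the exponential term does not
        see the scaling.\<close>
      define c where "c = 1 / sqrt (R n)"
      have c2: "c\<^sup>2 = 1 / R n"
        using elim(2) by (simp add: c_def power_divide)
      have g: "(\<lambda>x. c * fn n x) \<in> form_dom Q (Dn n) (\<nu>n n)"
        and Fg: "?F n (\<lambda>x. c * fn n x) = c\<^sup>2 * ?F n (fn n)"
        using form_scale[OF finite_measures(2) borel(2) assms(9) elim(1)] by blast+
      have "(\<integral>x. (c * fn n x)\<^sup>2 \<partial>\<nu>n n) = c\<^sup>2 * R n"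
        by (simp add: R_def power_mult_distrib)
      then have "(\<integral>x. (c * fn n x)\<^sup>2 \<partial>\<nu>n n) = 1"
        using elim(2) by (simp add: c2)
      from integral_le_rel_entropy[OF prob(2) L2.scale_mem[OF L2(1)] assms(12)[OF g this]
          continuous_measurable(2)[OF \<psi>(1)] M]
      have "(\<integral>x. \<psi> x * (c * fn n x)\<^sup>2 \<partial>\<nu>n n) \<le>
          2 * C * (c\<^sup>2 * ?F n (fn n)) + (\<integral>x. exp (\<psi> x - 1) \<partial>\<nu>n n)"
        by (simp only: Fg)
      moreover have "(\<integral>x. \<psi> x * (c * fn n x)\<^sup>2 \<partial>\<nu>n n) = c\<^sup>2 * (\<integral>x. \<psi> x * (fn n x)\<^sup>2 \<partial>\<nu>n n)"
        by (simp add: power_mult_distrib mult.left_commute[of _ "c\<^sup>2"])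
      ultimately show ?case
        by (simp add: c2)
    qed
    with lhs rhs show ?thesis
      by (intro tendsto_le[OF _ rhs lhs]) simp
  qed
  \<comment> \<open>The cylinder functions that witness strong convergence also approximate f in the
    limit space, and so serve to build the test functions there.\<close>
  obtain \<phi> where \<phi>: "\<And>m. \<phi> m \<in> FCb_infinity" "(\<lambda>m. L2_norm \<nu> (\<lambda>x. \<phi> m x - f x)) \<longlonglongrightarrow> 0"
    using fn unfolding L2_strong_conv_def by blast
  show "rel_entropy (density \<nu> (\<lambda>x. ennreal ((f x)\<^sup>2))) \<nu> \<le> ereal (2 * C * form Q D \<nu> f f)"
    by (rule rel_entropy_le_of_dual[OF prob(1) borel(1) L2(2) norm
          FCb_infinity_continuous[OF \<phi>(1)] FCb_infinity_bounded[OF \<phi>(1)] \<phi>(2) dual])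
qed

end
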